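(* Let $\mu$ be a finitely supported, generating probability measure on an irreducible right-angled Artin group $A(\Gamma)$, and $(w_n)$ the associated random walk. Then for every $k>0$ there exists $C>0$ such that for all $n\ge2$ $$\mathbb P\Big(\sup_K d_K(1,w_n)\ge C\log n\Big)\le C n^{-k},$$ where the supremum is over all join subcomplexes $K$ of $X(\Gamma)$. Consequently, for almost every sample path there is $C>0$ such that $\sup_K d_K(1,w_n)\le C\log n$ for all $n\ge2$.
   Context: $\Gamma$ is a finite simplicial graph, $A(\Gamma)=\langle V(\Gamma)\mid[v,w]=1\text{ for each edge }(v,w)\rangle$; $A(\Gamma)$ is irreducible if $\Gamma$ is not a join, where a join is an induced subgraph whose vertex set splits into two nonempty sets $A,B$ with every vertex of $A$ adjacent to every vertex of $B$. $X(\Gamma)$ is the universal cover of the Salvetti complex, a CAT(0) cube complex whose 1-skeleton is the Cayley graph of $A(\Gamma)$ (vertices identified with group elements). For an induced subgraph $J$, $X(J)$ is the convex subcomplex through the identity vertex whose 1-skeleton is the Cayley graph of $A(J)$; a join subcomplex is a translate $g X(J)$ with $J$ a join. For a convex subcomplex $K$, the gate $\mathfrak g_K(x)$ of a vertex $x$ is the unique closest vertex of $K$, and $d_K(x,y)=d(\mathfrak g_K(x),\mathfrak g_K(y))$. The random walk is $w_n=g_1\cdots g_n$ with $(g_i)$ i.i.d. of law $\mu$; $\mu$ is generating if the semigroup generated by its support is $A(\Gamma)$. *)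

theory Defs
  imports "HOL-Probability.Probability"
begin

text \<open>The graph Gamma is given by a finite vertex set V and an edge relation E.
  Elements of A(Gamma) are represented as equivalence classes of words over
  letters (v, True) = v and (v, False) = v^-1, v in V.\<close>

fun inv_letter :: "'v \<times> bool \<Rightarrow> 'v \<times> bool" where
  "inv_letter (v, b) = (v, \<not> b)"

definition raag_step :: "'v set \<Rightarrow> ('v \<Rightarrow> 'v \<Rightarrow> bool) \<Rightarrow>
    ('v \<times> bool) list \<Rightarrow> ('v \<times> bool) list \<Rightarrow> bool" where
  "raag_step V E xs ys \<longleftrightarrow>
     xs \<in> lists (V \<times> UNIV) \<and> ys \<in> lists (V \<times> UNIV) \<and>
     ((\<exists>as bs a. (xs = as @ [a, inv_letter a] @ bs \<and> ys = as @ bs)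
               \<or> (ys = as @ [a, inv_letter a] @ bs \<and> xs = as @ bs))
      \<or> (\<exists>as bs v b w c. E v w \<and> xs = as @ [(v, b), (w, c)] @ bs
                                \<and> ys = as @ [(w, c), (v, b)] @ bs))"

definition raag_class :: "'v set \<Rightarrow> ('v \<Rightarrow> 'v \<Rightarrow> bool) \<Rightarrow>
    ('v \<times> bool) list \<Rightarrow> ('v \<times> bool) list set" where
  "raag_class V E w = {w'. (raag_step V E)\<^sup>*\<^sup>* w w'}"

definition raag_carrier :: "'v set \<Rightarrow> ('v \<Rightarrow> 'v \<Rightarrow> bool) \<Rightarrow> ('v \<times> bool) list set set" where
  "raag_carrier V E = raag_class V E ` lists (V \<times> UNIV)"

definition raag_one :: "'v set \<Rightarrow> ('v \<Rightarrow> 'v \<Rightarrow> bool) \<Rightarrow> ('v \<times> bool) list set" where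
  "raag_one V E = raag_class V E []"

definition raag_mult :: "'v set \<Rightarrow> ('v \<Rightarrow> 'v \<Rightarrow> bool) \<Rightarrow>
    ('v \<times> bool) list set \<Rightarrow> ('v \<times> bool) list set \<Rightarrow> ('v \<times> bool) list set" where
  "raag_mult V E g h = raag_class V E ((SOME w. w \<in> g) @ (SOME w. w \<in> h))"

text \<open>Graph distance in the Cayley graph = 1-skeleton of X(Gamma).\<close>

definition raag_dist :: "'v set \<Rightarrow> ('v \<Rightarrow> 'v \<Rightarrow> bool) \<Rightarrow>
    ('v \<times> bool) list set \<Rightarrow> ('v \<times> bool) list set \<Rightarrow> nat" where
  "raag_dist V E g h = (LEAST n. \<exists>w \<in> lists (V \<times> UNIV).
       length w = n \<and> raag_mult V E g (raag_class V E w) = h)"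

text \<open>A(J) for the induced subgraph J on vertex set S, and vertex set of g X(J).\<close>

definition raag_subgroup :: "'v set \<Rightarrow> ('v \<Rightarrow> 'v \<Rightarrow> bool) \<Rightarrow> 'v set \<Rightarrow> ('v \<times> bool) list set set" where
  "raag_subgroup V E S = raag_class V E ` lists (S \<times> UNIV)"

definition raag_coset :: "'v set \<Rightarrow> ('v \<Rightarrow> 'v \<Rightarrow> bool) \<Rightarrow>
    ('v \<times> bool) list set \<Rightarrow> 'v set \<Rightarrow> ('v \<times> bool) list set set" where
  "raag_coset V E g S = raag_mult V E g ` raag_subgroup V E S"

definition is_join :: "('v \<Rightarrow> 'v \<Rightarrow> bool) \<Rightarrow> 'v set \<Rightarrow> bool" where
  "is_join E S \<longleftrightarrow> (\<exists>A B. A \<noteq> {} \<and> B \<noteq> {} \<and> A \<inter> B = {} \<and> A \<union> B = S \<and>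
                        (\<forall>a\<in>A. \<forall>b\<in>B. E a b))"

definition join_subcomplexes :: "'v set \<Rightarrow> ('v \<Rightarrow> 'v \<Rightarrow> bool) \<Rightarrow> ('v \<times> bool) list set set set" where
  "join_subcomplexes V E =
     {raag_coset V E g S | g S. g \<in> raag_carrier V E \<and> S \<subseteq> V \<and> is_join E S}"

definition gate :: "'v set \<Rightarrow> ('v \<Rightarrow> 'v \<Rightarrow> bool) \<Rightarrow>
    ('v \<times> bool) list set set \<Rightarrow> ('v \<times> bool) list set \<Rightarrow> ('v \<times> bool) list set" where
  "gate V E K x = (THE y. y \<in> K \<and> (\<forall>z\<in>K. raag_dist V E x y \<le> raag_dist V E x z))"

definition proj_dist :: "'v set \<Rightarrow> ('v \<Rightarrow> 'v \<Rightarrow> bool) \<Rightarrow>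
    ('v \<times> bool) list set set \<Rightarrow> ('v \<times> bool) list set \<Rightarrow> ('v \<times> bool) list set \<Rightarrow> nat" where
  "proj_dist V E K x y = raag_dist V E (gate V E K x) (gate V E K y)"

definition sup_join_proj :: "'v set \<Rightarrow> ('v \<Rightarrow> 'v \<Rightarrow> bool) \<Rightarrow>
    ('v \<times> bool) list set \<Rightarrow> ('v \<times> bool) list set \<Rightarrow> ereal" where
  "sup_join_proj V E x y = (SUP K \<in> join_subcomplexes V E. ereal (real (proj_dist V E K x y)))"

inductive_set raag_semigroup :: "'v set \<Rightarrow> ('v \<Rightarrow> 'v \<Rightarrow> bool) \<Rightarrow>
    ('v \<times> bool) list set set \<Rightarrow> ('v \<times> bool) list set set"
  for V E S where
  gen: "s \<in> S \<Longrightarrow> s \<in> raag_semigroup V E S"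
| mult: "a \<in> raag_semigroup V E S \<Longrightarrow> b \<in> raag_semigroup V E S \<Longrightarrow>
         raag_mult V E a b \<in> raag_semigroup V E S"

primrec rw_pmf :: "'v set \<Rightarrow> ('v \<Rightarrow> 'v \<Rightarrow> bool) \<Rightarrow> ('v \<times> bool) list set pmf \<Rightarrow> nat \<Rightarrow>
    ('v \<times> bool) list set pmf" where
  "rw_pmf V E \<mu> 0 = return_pmf (raag_one V E)"
| "rw_pmf V E \<mu> (Suc n) = bind_pmf (rw_pmf V E \<mu> n) (\<lambda>g. map_pmf (\<lambda>s. raag_mult V E g s) \<mu>)"

definition rw_path :: "'v set \<Rightarrow> ('v \<Rightarrow> 'v \<Rightarrow> bool) \<Rightarrow> ('v \<times> bool) list set stream \<Rightarrow> nat \<Rightarrow>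
    ('v \<times> bool) list set" where
  "rw_path V E \<omega> n = foldl (raag_mult V E) (raag_one V E) (stake n \<omega>)"

end

theory Submission
  imports Defs
begin

text \<open>Suppose that, seen from a point q of the path, reduced words for the two endpoints begin with
  chains (consecutive letters do not commute) through all vertices of Gamma, with first letters f and f',
  where f does not belong to the join J.  Then the gate of q in a translate of X(J) coincides with
  the gate of one of the endpoints, and f can be chosen for every proper J.  So if each window of
  length of order log n contains such a cut point, the last cut point whose gate is that of the start
  and the next cut point give the logarithmic bound.

  Cut points come from five blocks of steps, which are permutations of each other and hence equally
  likely.  Each block spells a long chain between two copies of a marker, and the markers are chosen
  such that the past can cancel at most one of the five, and likewise the future.\<close>

text \<open>Irreducibility enters twice: a proper \<open>S\<close> omits a vertex at which the path
  can be cut, and connectivity of the complement graph of Gamma provides the chain through all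
  vertices. A letter beyond such a chain could come to the front only by commuting with every
  vertex, its own included, so the first letter is forced whatever follows. The chain itself
  survives as soon as one letter of the adjacent marker survives; hence only complete absorption of
  a marker does harm. The probabilistic obstacle is that being a cut depends on the entire past and
  the entire future of a block, so these events are neither independent nor adapted to one direction
  of time. Multiplicative weights separate the two sides: if all blocks fail, a past weight or a
  future weight is at least 1, and each can be averaged by exposing blocks in its own direction.
  Five markers bring the mean per block below 1. The group is given only by classes of words, so
  lengths and gates rest on a normal form, obtained by letting letters act on reduced words.\<close>

lemma inv_letter_simps [simp]:
  "fst (inv_letter a) = fst a" "snd (inv_letter a) = (\<not> snd a)"
  "inv_letter (inv_letter a) = a" "inv_letter a \<noteq> a" "a \<noteq> inv_letter a"
  "inv_letter a = inv_letter b \<longleftrightarrow> a = b"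
  by (cases a; cases b; auto)+

definition inv_word :: "('v \<times> bool) list \<Rightarrow> ('v \<times> bool) list" where
  "inv_word w = rev (map inv_letter w)"

lemma inv_word_simps [simp]:
  "inv_word [] = []" "inv_word (a # w) = inv_word w @ [inv_letter a]"
  "inv_word (u @ w) = inv_word w @ inv_word u" "inv_word (inv_word w) = w"
  "length (inv_word w) = length w" "inv_word w = [] \<longleftrightarrow> w = []"
  by (auto simp: inv_word_def rev_map o_def)

lemma inv_word_in_lists [simp]: "inv_word w \<in> lists (S \<times> UNIV) \<longleftrightarrow> w \<in> lists (S \<times> UNIV)"
  by (induction w) (auto simp: mem_Times_iff)

locale raag =
  fixes V :: "'v set" and E :: "'v \<Rightarrow> 'v \<Rightarrow> bool"
  assumes E_sym: "E v w \<Longrightarrow> E w v" and E_irrefl [simp]: "\<not> E v v"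
begin

subsection \<open>Reduced words\<close>

text \<open>Equality in the partially commutative monoid: letters are shuffled but never cancelled.
  Separating the two kinds of moves makes the length and the multiset of letters invariant.\<close>

inductive teq :: "('v \<times> bool) list \<Rightarrow> ('v \<times> bool) list \<Rightarrow> bool" where
  refl [simp, intro]: "teq w w"
| swap: "E (fst x) (fst y) \<Longrightarrow> teq (x # y # w) (y # x # w)"
| cons: "teq u w \<Longrightarrow> teq (a # u) (a # w)"
| trans [trans]: "teq u w \<Longrightarrow> teq w x \<Longrightarrow> teq u x"

lemma teq_sym: "teq u w \<Longrightarrow> teq w u"
  by (induction rule: teq.induct) (blast intro: teq.refl teq.swap teq.cons E_sym teq.trans)+

lemma teq_append_right: "teq u w \<Longrightarrow> teq (u @ x) (w @ x)"
  by (induction rule: teq.induct) (simp_all add: teq.swap teq.cons, blast intro: teq.trans)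

lemma teq_append_left: "teq u w \<Longrightarrow> teq (x @ u) (x @ w)"
  by (induction x) (auto intro: teq.cons)

lemma teq_rev: "teq u w \<Longrightarrow> teq (rev u) (rev w)"
proof (induction rule: teq.induct)
  case (swap x y w)
  have "teq (rev w @ [y, x]) (rev w @ [x, y])"
    by (intro teq_append_left teq.swap E_sym[OF swap])
  then show ?case by simp
qed (auto intro: teq_append_right, blast intro: teq.trans)

lemma teq_mset: "teq u w \<Longrightarrow> mset u = mset w"
  by (induction rule: teq.induct) auto

lemma teq_length: "teq u w \<Longrightarrow> length u = length w"
  by (metis teq_mset size_mset)

lemma teq_set: "teq u w \<Longrightarrow> set u = set w"
  by (metis teq_mset set_mset_mset)

lemma teq_lists: "teq u w \<Longrightarrow> u \<in> lists A \<longleftrightarrow> w \<in> lists A"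
  by (auto simp: in_lists_conv_set dest: teq_set)

text \<open>No swap involves two letters satisfying \<open>P\<close>, so the subsequence they form
  is a shuffle invariant. It later allows markers to be compared literally.\<close>

lemma teq_filter:
  assumes "teq u w" "\<And>x y. P x \<Longrightarrow> P y \<Longrightarrow> \<not> E (fst x) (fst y)"
  shows "filter P u = filter P w"
  using assms(1) by (induction rule: teq.induct) (auto dest: assms(2))

text \<open>First letters up to shuffles: the result is what remains after \<open>a\<close> has been
  moved to the front and deleted, and \<open>None\<close> if \<open>a\<close> cannot get
  there.\<close>

primrec pull :: "'v \<times> bool \<Rightarrow> ('v \<times> bool) list \<Rightarrow> ('v \<times> bool) list option" where
  "pull a [] = None"
| "pull a (x # w) =
     (if x = a then Some w
      else if E (fst a) (fst x) then map_option (Cons x) (pull a w) else None)"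

lemma pull_SomeD: "pull a w = Some w' \<Longrightarrow> teq w (a # w')"
proof (induction w arbitrary: w')
  case (Cons x w)
  show ?case
  proof (cases "x = a")
    case False
    with Cons.prems obtain y where y: "E (fst a) (fst x)" "pull a w = Some y" "w' = x # y"
      by (auto split: if_splits)
    have "teq (x # w) (x # a # y)" using Cons.IH[OF y(2)] by (rule teq.cons)
    also have "teq (x # a # y) (a # x # y)" using E_sym[OF y(1)] by (rule teq.swap)
    finally show ?thesis using y by simp
  qed (use Cons.prems in auto)
qed simp

lemma pull_teq: "teq u w \<Longrightarrow> rel_option teq (pull a u) (pull a w)"
proof (induction rule: teq.induct)
  case (refl w)
  show ?case by (rule option.rel_refl) auto
next
  case (swap x y w)
  then show ?case by (cases "pull a w") (auto intro: teq.swap dest: E_sym)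
next
  case (cons u w b)
  then show ?case by (cases "pull a u"; cases "pull a w") (auto intro: teq.cons)
next
  case (trans u w x)
  then show ?case
    by (cases "pull a u"; cases "pull a w"; cases "pull a x") (auto intro: teq.trans)
qed

lemma pull_teq_None: "teq u w \<Longrightarrow> pull a u = None \<longleftrightarrow> pull a w = None"
  by (drule pull_teq[of _ _ a]) (auto simp: option_rel_Some1 option_rel_Some2)

lemma pull_append:
  "pull a (u @ w) = (case pull a u of Some y \<Rightarrow> Some (y @ w)
     | None \<Rightarrow> if \<forall>x\<in>set u. E (fst a) (fst x) then map_option ((@) u) (pull a w) else None)"
proof (induction u)
  case Nil
  show ?case by (cases "pull a w") simp_all
next
  case (Cons x u)
  then show ?case by (cases "pull a u"; cases "pull a w") (auto)
qed

text \<open>The later of the two letters has to pass the earlier one on its way to the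
  front.\<close>

lemma pull_pull_commute: "pull a w \<noteq> None \<Longrightarrow> pull b w \<noteq> None \<Longrightarrow> a \<noteq> b \<Longrightarrow> E (fst a) (fst b)"
  by (induction w) (auto split: if_splits dest: E_sym)

lemma pull_in_set: "pull a w \<noteq> None \<Longrightarrow> a \<in> set w"
  by (induction w) (auto split: if_splits)

primrec reduced :: "('v \<times> bool) list \<Rightarrow> bool" where
  "reduced [] \<longleftrightarrow> True"
| "reduced (a # w) \<longleftrightarrow> pull (inv_letter a) w = None \<and> reduced w"

lemma reduced_teq: "teq u w \<Longrightarrow> reduced u \<longleftrightarrow> reduced w"
proof (induction rule: teq.induct)
  case (swap x y w)
  then show ?case by (auto dest: E_sym)
qed (auto dest: pull_teq_None)

lemma reduced_append_right: "reduced (u @ w) \<Longrightarrow> reduced w"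
  by (induction u) auto

lemma reduced_append_left: "reduced (u @ w) \<Longrightarrow> reduced u"
  by (induction u) (auto simp: pull_append split: option.splits)

lemma reduced_pull:
  assumes "reduced w" "pull a w = Some w'"
  shows "reduced w'" "pull (inv_letter a) w' = None"
  using reduced_teq[OF pull_SomeD[OF assms(2)]] assms(1) by auto

text \<open>Left multiplication of a reduced word by a letter, cancelling when possible. As in van
  der Waerden's argument for free products, the relations are checked on this action, here up to
  \<open>teq\<close>, instead of proving confluence of a rewriting system.\<close>

definition act :: "'v \<times> bool \<Rightarrow> ('v \<times> bool) list \<Rightarrow> ('v \<times> bool) list" where
  "act a w = (case pull (inv_letter a) w of None \<Rightarrow> a # w | Some w' \<Rightarrow> w')"

lemma act_teq: "teq u w \<Longrightarrow> teq (act a u) (act a w)"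
  using pull_teq[of u w "inv_letter a"] unfolding act_def
  by (auto split: option.splits intro: teq.cons)

lemma reduced_act: "reduced w \<Longrightarrow> reduced (act a w)"
  by (auto simp: act_def reduced_pull split: option.splits)

text \<open>Reducedness is what makes this work: after a cancellation, \<open>reduced_pull\<close>
  ensures that the remaining word does not begin with the inverse, so the letter is put back rather
  than cancelled again.\<close>

lemma act_inv: "reduced w \<Longrightarrow> teq (act a (act (inv_letter a) w)) w"
  unfolding act_def by (auto split: option.splits dest: reduced_pull pull_SomeD teq_sym)

text \<open>Adjacent vertices are distinct, so the two letters do not interact: pulling one inverse
  gives the same result before and after removal of the other.\<close>

lemma act_comm:
  assumes "E (fst a) (fst b)"
  shows "teq (act a (act b w)) (act b (act a w))"
proof -
  have ne: "a \<noteq> b" "inv_letter a \<noteq> b" "a \<noteq> inv_letter b"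
    using assms by auto
  have *: "rel_option teq (pull (inv_letter a) w) (map_option (Cons (inv_letter b)) (pull (inv_letter a) w'))"
    if "pull (inv_letter b) w = Some w'" "E (fst a) (fst b)" "inv_letter a \<noteq> inv_letter b" for a b w'
    using pull_teq[OF pull_SomeD[OF that(1)], of "inv_letter a"] that by simp
  show ?thesis
  proof (cases "pull (inv_letter a) w")
    case None
    show ?thesis
    proof (cases "pull (inv_letter b) w")
      case None
      with \<open>pull (inv_letter a) w = None\<close> show ?thesis
        using assms ne by (auto simp: act_def dest: E_sym intro: teq.swap)
    next
      case (Some w2)
      with None *[OF Some assms] show ?thesis
        using assms ne E_sym[OF assms] by (auto simp: act_def split: option.splits)
    qed
  next
    case (Some w1)
    show ?thesis
    proof (cases "pull (inv_letter b) w")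
      case None
      with Some *[OF Some E_sym[OF assms]] show ?thesis
        using assms ne by (auto simp: act_def split: option.splits)
    next
      case (Some w2)
      obtain w12 where 1: "pull (inv_letter a) w2 = Some w12" "teq w1 (inv_letter b # w12)"
        using *[OF Some assms] ne \<open>pull (inv_letter a) w = Some w1\<close> by (auto simp: option_rel_Some1)
      have "rel_option teq (pull (inv_letter b) w1) (Some w12)"
        using pull_teq[OF 1(2), of "inv_letter b"] by simp
      then show ?thesis using 1 Some \<open>pull (inv_letter a) w = Some w1\<close>
        by (auto simp: act_def option_rel_Some2 intro: teq_sym)
    qed
  qed
qed

definition nf :: "('v \<times> bool) list \<Rightarrow> ('v \<times> bool) list" where
  "nf w = foldr act w []"

lemma nf_simps [simp]: "nf [] = []" "nf (a # w) = act a (nf w)"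
  by (auto simp: nf_def)

lemma nf_append: "nf (u @ w) = foldr act u (nf w)"
  by (simp add: nf_def)

lemma reduced_nf [simp]: "reduced (nf w)"
  by (induction w) (auto intro: reduced_act)

lemma nf_reduced: "reduced w \<Longrightarrow> nf w = w"
  by (induction w) (auto simp: act_def)

lemma foldr_act_teq: "teq u w \<Longrightarrow> teq (foldr act x u) (foldr act x w)"
  by (induction x) (auto intro: act_teq)

lemma length_act: "length (act a w) \<le> Suc (length w)"
  "even (length (act a w)) \<longleftrightarrow> odd (length w)"
  using pull_SomeD[of "inv_letter a" w, THEN teq_length]
  by (auto simp: act_def split: option.splits)

lemma length_nf: "length (nf w) \<le> length w"
proof (induction w)
  case (Cons a w)
  then show ?case using length_act(1)[of a "nf w"] by simp
qed simp

text \<open>A letter adds at most one to the length, so equal lengths force that no letter of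
  \<open>w\<close> was cancelled in the evaluation.\<close>

lemma reduced_iff_length: "reduced w \<longleftrightarrow> length (nf w) = length w"
proof
  show "length (nf w) = length w \<Longrightarrow> reduced w"
  proof (induction w)
    case (Cons a w)
    have "length (nf w) = length w"
      using Cons.prems length_act(1)[of a "nf w"] length_nf[of w] by auto
    then have "reduced w" "nf w = w" using Cons.IH nf_reduced by auto
    then show ?case using Cons.prems length_act(2)[of a w] pull_SomeD[THEN teq_length]
      by (fastforce simp: act_def split: option.splits)
  qed simp
qed (simp add: nf_reduced)

lemma nf_in_lists: "w \<in> lists A \<Longrightarrow> nf w \<in> lists A"
proof (induction w)
  case (Cons a w)
  then show ?case using pull_SomeD[THEN teq_lists, of _ "nf w" _ A]
    by (auto simp: act_def split: option.splits)
qed simp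

subsection \<open>Words representing the same group element\<close>

abbreviation wds where "wds \<equiv> lists (V \<times> (UNIV :: bool set))"
abbreviation cls where "cls \<equiv> raag_class V E"

lemma raag_step_insert:
  assumes "as @ [a, inv_letter a] @ bs \<in> wds"
  shows "raag_step V E (as @ bs) (as @ [a, inv_letter a] @ bs)"
proof -
  have "as @ bs \<in> wds" using assms by simp
  then show ?thesis using assms unfolding raag_step_def by blast
qed

lemma raag_step_delete:
  assumes "as @ [a, inv_letter a] @ bs \<in> wds"
  shows "raag_step V E (as @ [a, inv_letter a] @ bs) (as @ bs)"
proof -
  have "as @ bs \<in> wds" using assms by simp
  then show ?thesis using assms unfolding raag_step_def by blast
qed

lemma raag_step_swap:
  assumes "as @ [x, y] @ bs \<in> wds" "E (fst x) (fst y)"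
  shows "raag_step V E (as @ [x, y] @ bs) (as @ [y, x] @ bs)"
proof -
  have "as @ [x, y] @ bs = as @ [(fst x, snd x), (fst y, snd y)] @ bs"
    "as @ [y, x] @ bs = as @ [(fst y, snd y), (fst x, snd x)] @ bs" by simp_all
  moreover have "as @ [y, x] @ bs \<in> wds" using assms(1) by auto
  ultimately show ?thesis using assms unfolding raag_step_def by blast
qed

lemma raag_step_cases [consumes 1, case_names delete insert swap]:
  assumes "raag_step V E u w"
  obtains as bs a where "u = as @ [a, inv_letter a] @ bs" "w = as @ bs" "as @ [a, inv_letter a] @ bs \<in> wds"
    | as bs a where "w = as @ [a, inv_letter a] @ bs" "u = as @ bs" "as @ [a, inv_letter a] @ bs \<in> wds"
    | as bs x y where "u = as @ [x, y] @ bs" "w = as @ [y, x] @ bs" "as @ [x, y] @ bs \<in> wds"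
        "E (fst x) (fst y)"
  using assms unfolding raag_step_def by (elim conjE disjE exE) auto

lemma raag_step_sym:
  assumes "raag_step V E u w"
  shows "raag_step V E w u"
  using assms
proof (cases rule: raag_step_cases)
  case (swap as bs x y)
  then show ?thesis using raag_step_swap[of as y x bs] by (auto dest: E_sym)
qed (blast intro: raag_step_insert raag_step_delete)+

lemma raag_step_context:
  assumes "raag_step V E u w" "x \<in> wds" "y \<in> wds"
  shows "raag_step V E (x @ u @ y) (x @ w @ y)"
  using assms(1)
proof (cases rule: raag_step_cases)
  case (delete as bs a)
  then show ?thesis using raag_step_delete[of "x @ as" a "bs @ y"] assms by auto
next
  case (insert as bs a)
  then show ?thesis using raag_step_insert[of "x @ as" a "bs @ y"] assms by auto
next
  case (swap as bs a b)
  then show ?thesis using raag_step_swap[of "x @ as" a b "bs @ y"] assms by auto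
qed

section \<open>Classes of words and their products\<close>

lemma raag_step_rtranclp_sym: "(raag_step V E)\<^sup>*\<^sup>* u w \<Longrightarrow> (raag_step V E)\<^sup>*\<^sup>* w u"
  by (induction rule: rtranclp_induct) (auto intro: converse_rtranclp_into_rtranclp raag_step_sym)

lemma cls_eq_iff: "cls u = cls w \<longleftrightarrow> (raag_step V E)\<^sup>*\<^sup>* u w"
  unfolding raag_class_def
  by (auto intro: rtranclp_trans raag_step_rtranclp_sym)

lemma cls_step: "raag_step V E u w \<Longrightarrow> cls u = cls w"
  by (simp add: cls_eq_iff)

lemma cls_append:
  assumes "cls u = cls u'" "cls w = cls w'" "u \<in> wds" "w \<in> wds" "u' \<in> wds" "w' \<in> wds"
  shows "cls (u @ w) = cls (u' @ w')"
proof -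
  have *: "cls (x @ u @ y) = cls (x @ w @ y)"
    if "cls u = cls w" "x \<in> wds" "y \<in> wds" for u w x y
  proof -
    have "(raag_step V E)\<^sup>*\<^sup>* u w" using that by (simp add: cls_eq_iff)
    then show ?thesis
      by induction (auto dest: raag_step_context[OF _ that(2,3)] cls_step)
  qed
  from *[OF assms(1), of "[]" w] *[OF assms(2), of u' "[]"] assms show ?thesis by simp
qed

lemma rtranclp_step_wds: "(raag_step V E)\<^sup>*\<^sup>* u w \<Longrightarrow> u \<in> wds \<Longrightarrow> w \<in> wds"
  by (induction rule: rtranclp_induct) (auto simp: raag_step_def)

lemma cls_mem: "w \<in> cls u \<Longrightarrow> cls w = cls u"
  by (metis cls_eq_iff mem_Collect_eq raag_class_def)

lemma mem_cls: "w \<in> cls w"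
  by (simp add: raag_class_def)

text \<open>The same choice as in \<open>raag_mult\<close>, named so that products can be computed
  on words.\<close>

definition rep :: "('v \<times> bool) list set \<Rightarrow> ('v \<times> bool) list" where
  "rep g = (SOME w. w \<in> g)"

lemma cls_rep_cls: "cls (rep (cls u)) = cls u"
  unfolding rep_def by (rule cls_mem) (rule someI[of _ u], rule mem_cls)

lemma rep_wds: "u \<in> wds \<Longrightarrow> rep (cls u) \<in> wds"
  using rtranclp_step_wds cls_rep_cls[of u] by (metis cls_eq_iff)

lemma mult_cls: "u \<in> wds \<Longrightarrow> w \<in> wds \<Longrightarrow> raag_mult V E (cls u) (cls w) = cls (u @ w)"
  unfolding raag_mult_def rep_def[symmetric]
  by (intro cls_append cls_rep_cls rep_wds)

lemma cls_rep: "g \<in> raag_carrier V E \<Longrightarrow> cls (rep g) = g \<and> rep g \<in> wds"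
  unfolding raag_carrier_def using cls_rep_cls rep_wds by blast

lemma cls_cancel: "a \<in> V \<times> UNIV \<Longrightarrow> w \<in> wds \<Longrightarrow> cls (a # inv_letter a # w) = cls w"
  using cls_step[OF raag_step_delete[of "[]" a w]] by (auto simp: mem_Times_iff)

lemma teq_cls: "teq u w \<Longrightarrow> u \<in> wds \<Longrightarrow> cls u = cls w"
proof (induction rule: teq.induct)
  case (swap x y w)
  then show ?case using cls_step[OF raag_step_swap[of "[]" x y w]] by simp
next
  case (cons u w a)
  then show ?case using cls_append[of "[a]" "[a]" u w] teq_lists by auto
next
  case (trans u w x)
  then show ?case using teq_lists by metis
qed simp

lemma cls_act: "a \<in> V \<times> UNIV \<Longrightarrow> w \<in> wds \<Longrightarrow> cls (act a w) = cls (a # w)"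
proof (cases "pull (inv_letter a) w")
  case (Some y)
  assume a: "a \<in> V \<times> UNIV" "w \<in> wds"
  have t: "teq w (inv_letter a # y)" using Some by (rule pull_SomeD)
  then have y: "inv_letter a # y \<in> wds" using a teq_lists by blast
  have "cls (a # w) = cls (a # inv_letter a # y)"
    using t a by (intro teq_cls teq.cons) auto
  also have "\<dots> = cls y" using a y by (intro cls_cancel) auto
  finally show ?thesis using Some by (simp add: act_def)
qed (simp add: act_def)

lemma cls_nf: "w \<in> wds \<Longrightarrow> cls (nf w) = cls w"
proof (induction w)
  case (Cons a w)
  have "cls (act a (nf w)) = cls ([a] @ nf w)"
    using Cons.prems by (simp add: cls_act nf_in_lists)
  also have "\<dots> = cls ([a] @ w)"
    using Cons by (intro cls_append) (auto simp: nf_in_lists)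
  finally show ?case by simp
qed simp

lemma step_nf:
  assumes "raag_step V E u w"
  shows "teq (nf u) (nf w)"
  using assms
proof (cases rule: raag_step_cases)
  case (insert as bs a)
  then show ?thesis by (auto simp: nf_append intro!: foldr_act_teq act_inv[THEN teq_sym])
qed (auto simp: nf_append intro!: foldr_act_teq act_comm act_inv)

text \<open>Together with \<open>cls_nf\<close> this solves the word problem: group elements
  correspond to reduced words up to shuffles.\<close>

lemma nf_cong: "cls u = cls w \<Longrightarrow> teq (nf u) (nf w)"
  unfolding cls_eq_iff by (induction rule: rtranclp_induct) (simp, blast dest: step_nf intro: teq.trans)

text \<open>Word length of the group element; \<open>dist_cls\<close> ties it to the Cayley graph
  distance.\<close>

definition glen :: "('v \<times> bool) list \<Rightarrow> nat" where
  "glen w = length (nf w)"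

lemma glen_cong: "cls u = cls w \<Longrightarrow> glen u = glen w"
  unfolding glen_def using nf_cong teq_length by blast

lemma glen_le: "glen w \<le> length w"
  by (simp add: glen_def length_nf)

lemma reduced_iff_glen: "reduced w \<longleftrightarrow> glen w = length w"
  by (simp add: glen_def reduced_iff_length)

section \<open>Inverses and the Cayley graph metric\<close>

lemma raag_step_inv:
  assumes "raag_step V E u w"
  shows "raag_step V E (inv_word u) (inv_word w)"
  using assms
proof (cases rule: raag_step_cases)
  case (delete as bs a)
  then show ?thesis using raag_step_delete[of "inv_word bs" a "inv_word as"] by (auto simp: mem_Times_iff)
next
  case (insert as bs a)
  then show ?thesis using raag_step_insert[of "inv_word bs" a "inv_word as"] by (auto simp: mem_Times_iff)
next
  case (swap as bs x y)
  then show ?thesis using raag_step_swap[of "inv_word bs" "inv_letter y" "inv_letter x" "inv_word as"]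
    by (auto simp: mem_Times_iff dest: E_sym)
qed

lemma cls_inv: "cls u = cls w \<Longrightarrow> cls (inv_word u) = cls (inv_word w)"
  unfolding cls_eq_iff
  by (induction rule: rtranclp_induct) (auto dest: raag_step_inv intro: rtranclp.rtrancl_into_rtrancl)

text \<open>Inverting a normal form gives a word of the same length for the inverse; this inequality
  is applied to \<open>w\<close> and to its inverse.\<close>

lemma glen_inv: "w \<in> wds \<Longrightarrow> glen (inv_word w) = glen w"
proof -
  have *: "glen (inv_word w) \<le> glen w" if w: "w \<in> wds" for w
  proof -
    have "glen (inv_word w) = glen (inv_word (nf w))"
      using w by (intro glen_cong cls_inv) (simp add: cls_nf)
    then show ?thesis using glen_le[of "inv_word (nf w)"] by (simp add: glen_def)
  qed
  assume "w \<in> wds"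
  then show ?thesis using *[of w] *[of "inv_word w"] by auto
qed

lemma cls_inv_cancel: "u \<in> wds \<Longrightarrow> w \<in> wds \<Longrightarrow> cls (u @ inv_word u @ w) = cls w"
proof (induction u arbitrary: w)
  case (Cons a u)
  have "cls ([a] @ (u @ inv_word u @ ([inv_letter a] @ w))) = cls ([a] @ ([inv_letter a] @ w))"
    using Cons.prems by (intro cls_append Cons.IH) (auto simp: mem_Times_iff)
  also have "\<dots> = cls w" using Cons.prems cls_cancel by auto
  finally show ?case by simp
qed simp

lemma cls_inv_cancel': "u \<in> wds \<Longrightarrow> w \<in> wds \<Longrightarrow> cls (inv_word u @ u @ w) = cls w"
  using cls_inv_cancel[of "inv_word u" w] by simp

lemma cls_append_left_cancel:
  assumes "u \<in> wds" "x \<in> wds" "y \<in> wds"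
  shows "cls (u @ x) = cls (u @ y) \<longleftrightarrow> cls x = cls y"
proof
  assume "cls (u @ x) = cls (u @ y)"
  then have "cls (inv_word u @ (u @ x)) = cls (inv_word u @ (u @ y))"
    by (rule cls_append[OF HOL.refl]) (use assms in simp_all)
  then show "cls x = cls y" using cls_inv_cancel' assms by metis
qed (rule cls_append, use assms in simp_all)

lemma cls_solve:
  assumes "u \<in> wds" "x \<in> wds" "y \<in> wds"
  shows "cls (u @ x) = cls y \<longleftrightarrow> cls x = cls (inv_word u @ y)"
  using cls_append_left_cancel[of "inv_word u" "u @ x" y] assms by (auto simp: cls_inv_cancel')

lemma glen_triangle:
  assumes "u \<in> wds" "w \<in> wds" shows "glen (u @ w) \<le> glen u + glen w"
proof -
  have "glen (u @ w) = glen (nf u @ nf w)"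
    using assms by (intro glen_cong cls_append) (auto simp: cls_nf nf_in_lists)
  also have "\<dots> \<le> glen u + glen w" using glen_le[of "nf u @ nf w"] by (simp add: glen_def)
  finally show ?thesis .
qed

lemma dist_cls:
  assumes "u \<in> wds" "w \<in> wds"
  shows "raag_dist V E (cls u) (cls w) = glen (inv_word u @ w)"
  unfolding raag_dist_def
proof (rule Least_equality)
  show "\<exists>x\<in>wds. length x = glen (inv_word u @ w) \<and> raag_mult V E (cls u) (cls x) = cls w"
    using assms
    by (intro bexI[of _ "nf (inv_word u @ w)"])
      (auto simp: mult_cls glen_def nf_in_lists cls_solve cls_nf)
next
  fix n assume "\<exists>x\<in>wds. length x = n \<and> raag_mult V E (cls u) (cls x) = cls w"
  then obtain x where x: "x \<in> wds" "length x = n" "cls (u @ x) = cls w"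
    using assms by (auto simp: mult_cls)
  then have "glen (inv_word u @ w) = glen x" using assms by (intro glen_cong) (simp add: cls_solve)
  then show "glen (inv_word u @ w) \<le> n" using x glen_le by metis
qed

subsection \<open>Gates\<close>

text \<open>Cancellation in \<open>z @ u\<close> can only happen across the seam, between a last
  letter of \<open>z\<close>, which \<open>pull\<close> detects on \<open>rev z\<close>, and an
  inverse first letter of \<open>u\<close>.\<close>

lemma reduced_append:
  assumes "reduced z" "reduced u" "\<And>a. pull a (rev z) \<noteq> None \<Longrightarrow> pull (inv_letter a) u = None"
  shows "reduced (z @ u)"
  using assms(1,3)
proof (induction z)
  case Nil
  then show ?case using assms by simp
next
  case (Cons b z)
  have 1: "reduced (z @ u)"
  proof (rule Cons.IH)
    fix a assume "pull a (rev z) \<noteq> None"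
    then show "pull (inv_letter a) u = None"
      using Cons.prems(2)[of a] by (auto simp: pull_append)
  qed (use Cons.prems in simp)
  have "pull (inv_letter b) (z @ u) = None"
  proof (cases "\<forall>x\<in>set z. E (fst b) (fst x)")
    case True
    then have "pull b (rev (b # z)) \<noteq> None"
      by (auto simp: pull_append split: option.splits)
    then have "pull (inv_letter b) u = None" using Cons.prems(2) by blast
    then show ?thesis using Cons.prems(1) by (simp add: pull_append)
  next
    case False
    then show ?thesis using Cons.prems(1) by (auto simp: pull_append)
  qed
  with 1 show ?case by simp
qed

text \<open>Letters over \<open>S\<close> are pulled out greedily until none is left in front. What
  remains is a shortest representative of the coset A(S)w.\<close>

lemma split_prefix:
  assumes "reduced w"
  shows "\<exists>p z. teq w (p @ z) \<and> p \<in> lists (S \<times> UNIV) \<and> (\<forall>s. fst s \<in> S \<longrightarrow> pull s z = None)"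
  using assms
proof (induction "length w" arbitrary: w)
  case 0
  show ?case by (intro exI[of _ "[]"] exI[of _ w]) (use 0 in simp)
next
  case (Suc n)
  show ?case
  proof (cases "\<exists>s. fst s \<in> S \<and> pull s w \<noteq> None")
    case False
    then show ?thesis by (intro exI[of _ "[]"] exI[of _ w]) auto
  next
    case True
    then obtain s w' where s: "fst s \<in> S" "pull s w = Some w'" by blast
    note t = pull_SomeD[OF s(2)]
    have l: "n = length w'" using teq_length[OF t] Suc(2) by simp
    obtain p z where pz: "teq w' (p @ z)" "p \<in> lists (S \<times> UNIV)" "\<forall>s. fst s \<in> S \<longrightarrow> pull s z = None"
      using Suc(1)[OF l] reduced_pull(1)[OF Suc(3) s(2)] by blast
    have "teq w ((s # p) @ z)" using teq.trans[OF t teq.cons[OF pz(1), of s]] by simp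
    moreover have "s # p \<in> lists (S \<times> UNIV)" using pz s(1) by (simp add: mem_Times_iff)
    ultimately show ?thesis using pz(3) by blast
  qed
qed

lemma S_words: "S \<subseteq> V \<Longrightarrow> p \<in> lists (S \<times> UNIV) \<Longrightarrow> p \<in> wds"
  by auto

lemma coset_eq:
  assumes "g \<in> wds" "S \<subseteq> V"
  shows "raag_coset V E (cls g) S = {cls (g @ s) |s. s \<in> lists (S \<times> UNIV)}"
proof -
  have "raag_mult V E (cls g) (cls s) = cls (g @ s)" if "s \<in> lists (S \<times> UNIV)" for s
    using mult_cls[OF assms(1) S_words[OF assms(2) that]] .
  then have "raag_coset V E (cls g) S = (\<lambda>s. cls (g @ s)) ` lists (S \<times> UNIV)"
    unfolding raag_coset_def raag_subgroup_def image_image by (intro image_cong) simp_all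
  then show ?thesis by blast
qed

text \<open>For a point g s of the coset, \<open>inv_word s @ p\<close> reduces to a word over
  \<open>S\<close>, which cannot cancel against \<open>z\<close>. The distance is therefore |s^-1 p|
  + |z|, minimal exactly when s and p represent the same element. This also gives the uniqueness
  behind \<open>THE\<close> in \<open>gate\<close>.\<close>

lemma gate_eq:
  assumes "g \<in> wds" "S \<subseteq> V" "p \<in> lists (S \<times> UNIV)" "z \<in> wds" "reduced z"
    "\<forall>s. fst s \<in> S \<longrightarrow> pull s z = None"
  shows "gate V E (raag_coset V E (cls g) S) (cls (g @ p @ z)) = cls (g @ p)"
proof -
  note pw = S_words[OF assms(2,3)]
  have d: "raag_dist V E (cls (g @ p @ z)) (cls (g @ s)) = glen (inv_word s @ p) + length z"
    if s: "s \<in> lists (S \<times> UNIV)" for s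
  proof -
    note sw = S_words[OF assms(2) s]
    let ?r = "nf (inv_word s @ p)"
    have r: "?r \<in> lists (S \<times> UNIV)" using s assms(3) by (intro nf_in_lists) simp
    have "reduced (?r @ z)"
    proof (rule reduced_append)
      fix a assume "pull a (rev ?r) \<noteq> None"
      then have "a \<in> set ?r" using pull_in_set by fastforce
      then show "pull (inv_letter a) z = None" using r by (intro assms(6)[rule_format]) auto
    qed (use assms in simp_all)
    then have l: "glen (?r @ z) = glen (inv_word s @ p) + length z"
      by (simp add: nf_reduced glen_def)
    have "raag_dist V E (cls (g @ p @ z)) (cls (g @ s)) = glen (inv_word (g @ p @ z) @ g @ s)"
      using assms pw sw by (intro dist_cls) auto
    also have "\<dots> = glen ((inv_word z @ inv_word p) @ s)"
    proof (rule glen_cong)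
      have "cls ((inv_word z @ inv_word p) @ (inv_word g @ g @ s)) = cls ((inv_word z @ inv_word p) @ s)"
        by (rule cls_append[OF HOL.refl cls_inv_cancel']) (use assms pw sw in simp_all)
      then show "cls (inv_word (g @ p @ z) @ g @ s) = cls ((inv_word z @ inv_word p) @ s)"
        by simp
    qed
    also have "\<dots> = glen (inv_word (inv_word s @ p @ z))" by simp
    also have "\<dots> = glen ((inv_word s @ p) @ z)"
      using glen_inv[of "inv_word s @ p @ z"] assms pw sw by simp
    also have "\<dots> = glen (?r @ z)"
      by (intro glen_cong cls_append) (use assms pw sw r S_words in \<open>auto simp: cls_nf\<close>)
    finally show ?thesis using l by simp
  qed
  have "glen (inv_word p @ p) = glen []"
    by (rule glen_cong) (use cls_inv_cancel'[of p "[]"] pw in simp)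
  then have dp: "raag_dist V E (cls (g @ p @ z)) (cls (g @ p)) = length z"
    using d[OF assms(3)] by (simp add: glen_def)
  let ?K = "raag_coset V E (cls g) S" and ?x = "cls (g @ p @ z)"
  have pK: "cls (g @ p) \<in> ?K"
    using assms(3) unfolding coset_eq[OF assms(1,2)] by blast
  show ?thesis
    unfolding gate_def
  proof (rule the_equality)
    show "cls (g @ p) \<in> ?K \<and> (\<forall>x\<in>?K. raag_dist V E ?x (cls (g @ p)) \<le> raag_dist V E ?x x)"
    proof (intro conjI ballI)
      fix y assume "y \<in> ?K"
      then obtain s where s: "y = cls (g @ s)" "s \<in> lists (S \<times> UNIV)"
        unfolding coset_eq[OF assms(1,2)] by blast
      show "raag_dist V E ?x (cls (g @ p)) \<le> raag_dist V E ?x y"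
        unfolding s(1) dp d[OF s(2)] by simp
    qed (rule pK)
  next
    fix y assume y: "y \<in> ?K \<and> (\<forall>x\<in>?K. raag_dist V E ?x y \<le> raag_dist V E ?x x)"
    then obtain s where s: "y = cls (g @ s)" "s \<in> lists (S \<times> UNIV)"
      unfolding coset_eq[OF assms(1,2)] by blast
    have "raag_dist V E ?x y \<le> raag_dist V E ?x (cls (g @ p))" using y pK by blast
    then have "glen (inv_word s @ p) = 0" unfolding s(1) dp d[OF s(2)] by simp
    then have "nf (inv_word s @ p) = []" by (simp add: glen_def)
    then have "cls (inv_word s @ p) = cls []"
      using cls_nf[of "inv_word s @ p"] pw S_words[OF assms(2) s(2)] by simp
    then have "cls p = cls s"
      using cls_solve[of "inv_word s" p "[]"] pw S_words[OF assms(2) s(2)] by simp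
    then show "y = cls (g @ p)"
      unfolding s by (intro cls_append) (use assms pw S_words[OF assms(2) s(2)] in auto)
  qed
qed

lemma gate_decomp:
  assumes "g \<in> wds" "S \<subseteq> V" "x \<in> wds"
  obtains p z where "p \<in> lists (S \<times> UNIV)" "z \<in> wds" "reduced z" "cls x = cls (g @ p @ z)"
    "\<forall>s. fst s \<in> S \<longrightarrow> pull s z = None"
proof -
  let ?w = "nf (inv_word g @ x)"
  have w: "?w \<in> wds" using assms by (intro nf_in_lists) auto
  obtain p z where pz: "teq ?w (p @ z)" "p \<in> lists (S \<times> UNIV)" "\<forall>s. fst s \<in> S \<longrightarrow> pull s z = None"
    using split_prefix[OF reduced_nf] by blast
  have pzw: "p @ z \<in> wds" using teq_lists[OF pz(1)] w by blast
  moreover have "reduced z"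
    using reduced_teq[OF pz(1)] reduced_append_right by auto
  moreover have "cls (inv_word g @ x) = cls (p @ z)"
    using teq_cls[OF pz(1) w] cls_nf[of "inv_word g @ x"] assms by auto
  then have "cls x = cls (g @ p @ z)"
    using cls_solve[of g "p @ z" x] assms pzw by simp
  ultimately show ?thesis using that pz by auto
qed

lemma gate_in_carrier:
  assumes "g \<in> wds" "S \<subseteq> V" "x \<in> wds"
  shows "gate V E (raag_coset V E (cls g) S) (cls x) \<in> raag_carrier V E"
proof -
  obtain p z where pz: "p \<in> lists (S \<times> UNIV)" "z \<in> wds" "reduced z" "cls x = cls (g @ p @ z)"
    "\<forall>s. fst s \<in> S \<longrightarrow> pull s z = None" using gate_decomp[OF assms] .
  then show ?thesis
    using gate_eq[OF assms(1,2) pz(1-3,5)] assms S_words[OF assms(2) pz(1)]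
    by (auto simp: raag_carrier_def)
qed

section \<open>The metric, and gates as 1-Lipschitz maps\<close>

lemma dist_triangle:
  assumes "x \<in> raag_carrier V E" "y \<in> raag_carrier V E" "z \<in> raag_carrier V E"
  shows "raag_dist V E x z \<le> raag_dist V E x y + raag_dist V E y z"
proof -
  obtain a b c where w: "x = cls a" "y = cls b" "z = cls c" "a \<in> wds" "b \<in> wds" "c \<in> wds"
    using assms by (auto simp: raag_carrier_def)
  have "cls (inv_word a @ (b @ inv_word b @ c)) = cls (inv_word a @ c)"
    by (rule cls_append[OF HOL.refl cls_inv_cancel]) (use w in simp_all)
  then have "glen (inv_word a @ c) = glen ((inv_word a @ b) @ (inv_word b @ c))"
    by (intro glen_cong) simp
  also have "\<dots> \<le> glen (inv_word a @ b) + glen (inv_word b @ c)"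
    by (rule glen_triangle) (use w in simp_all)
  finally show ?thesis using w by (simp add: dist_cls)
qed

lemma dist_sym:
  assumes "x \<in> raag_carrier V E" "y \<in> raag_carrier V E"
  shows "raag_dist V E x y = raag_dist V E y x"
proof -
  obtain a b where w: "x = cls a" "y = cls b" "a \<in> wds" "b \<in> wds"
    using assms by (auto simp: raag_carrier_def)
  then show ?thesis using glen_inv[of "inv_word a @ b"] by (simp add: dist_cls)
qed

lemma dist_append_le:
  assumes "x \<in> wds" "w \<in> wds"
  shows "raag_dist V E (cls x) (cls (x @ w)) \<le> length w"
proof -
  have "glen (inv_word x @ x @ w) = glen w"
    using assms by (intro glen_cong cls_inv_cancel')
  then show ?thesis using assms glen_le[of w] by (simp add: dist_cls)
qed

lemma dist_refl: "x \<in> raag_carrier V E \<Longrightarrow> raag_dist V E x x = 0"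
  using dist_append_le[of _ "[]"] by (auto simp: raag_carrier_def)

text \<open>With x = g p z, the new letter either cancels at the end of \<open>z\<close>, or extends
  \<open>z\<close> without creating a first letter over \<open>S\<close>, or lies over
  \<open>S\<close> and commutes with all of \<open>z\<close>. Only in the last case does the gate
  move, and then by that single letter.\<close>

lemma gate_step:
  assumes "g \<in> wds" "S \<subseteq> V" "x \<in> wds" "a \<in> V \<times> UNIV"
  shows "proj_dist V E (raag_coset V E (cls g) S) (cls x) (cls (x @ [a])) \<le> 1"
proof -
  let ?K = "raag_coset V E (cls g) S"
  obtain p z where pz: "p \<in> lists (S \<times> UNIV)" "z \<in> wds" "reduced z" "cls x = cls (g @ p @ z)"
    "\<forall>s. fst s \<in> S \<longrightarrow> pull s z = None" using gate_decomp[OF assms(1-3)] .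
  note pw = S_words[OF assms(2) pz(1)]
  have aw: "[a] \<in> wds" using assms(4) by simp
  have gx: "gate V E ?K (cls x) = cls (g @ p)"
    using gate_eq[OF assms(1,2) pz(1-3,5)] pz(4) by simp
  have xa: "cls (x @ [a]) = cls ((g @ p @ z) @ [a])"
    by (rule cls_append[OF pz(4) HOL.refl]) (use assms pz pw in simp_all)
  have same: ?thesis if "gate V E ?K (cls (x @ [a])) = cls (g @ p)"
    unfolding proj_dist_def gx that using dist_append_le[of "g @ p" "[]"] assms pw by simp
  show ?thesis
  proof (cases "pull (inv_letter a) (rev z)")
    case (Some y)
    have t: "teq z (rev y @ [inv_letter a])" using teq_rev[OF pull_SomeD[OF Some]] by simp
    have yw: "rev y \<in> wds" using teq_lists[OF t] pz(2) by auto
    have "reduced (rev y)" using t pz(3) reduced_teq reduced_append_left by blast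
    moreover have "pull s (rev y) = None" if "fst s \<in> S" for s
      using pz(5)[rule_format, OF that] pull_teq_None[OF t, of s] by (auto simp: pull_append split: option.splits)
    ultimately have "gate V E ?K (cls (g @ p @ rev y)) = cls (g @ p)"
      using gate_eq assms pz yw by blast
    moreover have "cls ((g @ p @ z) @ [a]) = cls (g @ p @ rev y)"
    proof -
      have "cls ((g @ p) @ (z @ [a])) = cls ((g @ p) @ (rev y @ [inv_letter a, a]))"
        using teq_append_right[OF t, of "[a]"] assms pz pw yw
        by (intro cls_append[OF HOL.refl] teq_cls) auto
      also have "\<dots> = cls (((g @ p) @ rev y) @ [])"
        unfolding append_assoc[symmetric]
        by (rule cls_append[OF HOL.refl]) (use assms pz pw yw cls_cancel[of "inv_letter a" "[]"] in \<open>auto simp: mem_Times_iff\<close>)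
      finally show ?thesis by simp
    qed
    ultimately show ?thesis using xa by (intro same) simp
  next
    case None
    have r: "reduced (z @ [a])"
      by (rule reduced_append) (use pz None in \<open>auto split: if_splits\<close>)
    show ?thesis
    proof (cases "\<forall>s. fst s \<in> S \<longrightarrow> pull s (z @ [a]) = None")
      case True
      then have "gate V E ?K (cls (g @ p @ (z @ [a]))) = cls (g @ p)"
        using pz assms r by (intro gate_eq) auto
      then show ?thesis using xa by (intro same) simp
    next
      case False
      then obtain s where s: "fst s \<in> S" "pull s (z @ [a]) \<noteq> None" by blast
      then have sa: "s = a" "pull a (z @ [a]) = Some z"
        using pz(5)[rule_format, OF s(1)] by (auto simp: pull_append split: if_splits)
      have "gate V E ?K (cls (g @ (p @ [a]) @ z)) = cls (g @ (p @ [a]))"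
        using pz assms s sa by (intro gate_eq) (auto simp: mem_Times_iff)
      moreover have "cls ((g @ p) @ (z @ [a])) = cls ((g @ p) @ (a # z))"
        by (intro cls_append[OF HOL.refl] teq_cls pull_SomeD[OF sa(2)]) (use assms pz pw in auto)
      ultimately have "gate V E ?K (cls (x @ [a])) = cls ((g @ p) @ [a])"
        using xa by simp
      then show ?thesis
        unfolding proj_dist_def gx using dist_append_le[of "g @ p" "[a]"] assms pw aw by simp
    qed
  qed
qed

lemma proj_dist_append:
  assumes "g \<in> wds" "S \<subseteq> V" "x \<in> wds" "w \<in> wds"
  shows "proj_dist V E (raag_coset V E (cls g) S) (cls x) (cls (x @ w)) \<le> length w"
  using assms(4)
proof (induction w rule: rev_induct)
  case Nil
  then show ?case using dist_refl gate_in_carrier assms by (simp add: proj_dist_def)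
next
  case (snoc a w)
  have "proj_dist V E (raag_coset V E (cls g) S) (cls x) (cls ((x @ w) @ [a])) \<le> length w + 1"
    using snoc gate_step[OF assms(1,2), of "x @ w" a] assms
      dist_triangle[OF gate_in_carrier[OF assms(1-3)] gate_in_carrier[OF assms(1,2), of "x @ w"]
        gate_in_carrier[OF assms(1,2), of "x @ w @ [a]"]]
    unfolding proj_dist_def by auto
  then show ?case by simp
qed

text \<open>Write q = g p z with cls (g @ p) the gate of q.  If u moves the gate, then z ends with the inverse
  of f, because f is not in S; if u' moves it, then z ends with the inverse of f' or commutes with f'.
  Both together make f and f' adjacent.\<close>

lemma gate_cut:
  assumes "g \<in> wds" "S \<subseteq> V" "q \<in> wds" "u \<in> wds" "u' \<in> wds" "reduced u" "reduced u'"
    and f: "\<And>a. pull a u \<noteq> None \<Longrightarrow> a = f" and f': "\<And>a. pull a u' \<noteq> None \<Longrightarrow> a = f'"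
    and "f \<noteq> f'" "\<not> E (fst f) (fst f')" "fst f \<notin> S"
  defines "K \<equiv> raag_coset V E (cls g) S"
  shows "gate V E K (cls (q @ u)) = gate V E K (cls q) \<or> gate V E K (cls (q @ u')) = gate V E K (cls q)"
proof (rule ccontr)
  assume neg: "\<not> ?thesis"
  obtain p z where pz: "p \<in> lists (S \<times> UNIV)" "z \<in> wds" "reduced z" "cls q = cls (g @ p @ z)"
    "\<forall>s. fst s \<in> S \<longrightarrow> pull s z = None" using gate_decomp[OF assms(1-3)] .
  note pw = S_words[OF assms(2) pz(1)]
  have gq: "gate V E K (cls q) = cls (g @ p)"
    using gate_eq[OF assms(1,2) pz(1-3,5)] pz(4) unfolding K_def by simp
  \<comment> \<open>If \<open>h\<close> neither cancels at the end of \<open>z\<close> nor passes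
    through \<open>z\<close> into \<open>S\<close>, then \<open>z @ t\<close> is reduced and still
    has no first letter over \<open>S\<close>, so q t keeps the prefix \<open>p\<close> and with it
    the gate.\<close>
  have change: "pull (inv_letter h) (rev z) \<noteq> None \<or> fst h \<in> S \<and> (\<forall>x\<in>set z. E (fst h) (fst x))"
    if t: "t \<in> wds" "reduced t" "\<And>a. pull a t \<noteq> None \<Longrightarrow> a = h"
      and ne: "gate V E K (cls (q @ t)) \<noteq> gate V E K (cls q)" for t h
  proof (rule ccontr)
    assume c: "\<not> ?thesis"
    have r: "reduced (z @ t)"
    proof (rule reduced_append)
      fix a assume "pull a (rev z) \<noteq> None"
      then show "pull (inv_letter a) t = None"
        using t(3)[of "inv_letter a"] c inv_letter_simps(3)[of a] by metis
    qed (use pz t in auto)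
    have nb: "pull s (z @ t) = None" if "fst s \<in> S" for s
    proof -
      have "pull s t = None \<or> s = h" using t(3)[of s] by blast
      then show ?thesis
        using pz(5)[rule_format, OF that] c that by (auto simp: pull_append)
    qed
    have "gate V E K (cls (g @ p @ (z @ t))) = cls (g @ p)"
      unfolding K_def using pz assms r t nb by (intro gate_eq) auto
    moreover have "cls (q @ t) = cls ((g @ p @ z) @ t)"
      by (rule cls_append[OF pz(4) HOL.refl]) (use assms pz pw t in simp_all)
    ultimately show False using ne gq by simp
  qed
  have 1: "pull (inv_letter f) (rev z) \<noteq> None"
    using change[of u f] neg assms by blast
  have "pull (inv_letter f') (rev z) \<noteq> None \<or> (\<forall>x\<in>set z. E (fst f') (fst x))"
    using change[of u' f'] neg assms by blast
  then show False
  proof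
    assume "pull (inv_letter f') (rev z) \<noteq> None"
    then have "E (fst f) (fst f')"
      using pull_pull_commute[OF 1, of "inv_letter f'"] \<open>f \<noteq> f'\<close> by simp
    then show False using assms by blast
  next
    assume "\<forall>x\<in>set z. E (fst f') (fst x)"
    moreover have "inv_letter f \<in> set z" using pull_in_set[OF 1] by simp
    ultimately show False using assms E_sym by fastforce
  qed
qed

subsection \<open>Chains\<close>

text \<open>Neither a shuffle nor a cancellation applies to neighbouring letters, so such a word is
  rigid: only its first letter can be brought to the front.\<close>

definition chain :: "('v \<times> bool) list \<Rightarrow> bool" where
  "chain = successively (\<lambda>a b. \<not> E (fst a) (fst b) \<and> b \<noteq> inv_letter a)"

lemma chain_Cons: "chain (a # b # w) \<longleftrightarrow> \<not> E (fst a) (fst b) \<and> b \<noteq> inv_letter a \<and> chain (b # w)"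
  by (auto simp: chain_def)

lemma chain_single: "chain [x]"
  by (simp add: chain_def)

lemma chain_append: "chain (u @ w) \<longleftrightarrow> chain u \<and> chain w \<and>
   (u \<noteq> [] \<longrightarrow> w \<noteq> [] \<longrightarrow> \<not> E (fst (last u)) (fst (hd w)) \<and> hd w \<noteq> inv_letter (last u))"
  by (auto simp: chain_def successively_append_iff)

lemma chain_inv: "chain w \<Longrightarrow> chain (inv_word w)"
proof (induction w)
  case (Cons a w)
  show ?case
  proof (cases w)
    case (Cons b w')
    then have "chain (inv_word w)" "last (inv_word w) = inv_letter b"
      "\<not> E (fst a) (fst b)" "b \<noteq> inv_letter a"
      using Cons.IH Cons.prems by (auto simp: chain_Cons)
    then show ?thesis by (auto simp: chain_append dest: E_sym) (simp_all add: chain_def)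
  qed (simp add: chain_def)
qed simp

lemma chain_pull: "chain (f # c) \<Longrightarrow> pull a (f # c) \<noteq> None \<Longrightarrow> a = f"
proof (induction c arbitrary: f)
  case (Cons b c)
  show ?case
  proof (rule ccontr)
    assume "a \<noteq> f"
    then have "E (fst a) (fst f)" "pull a (b # c) \<noteq> None" using Cons.prems(2) by (auto split: if_splits)
    with Cons.IH[of b] Cons.prems(1) show False by (auto simp: chain_Cons dest: E_sym)
  qed
qed (auto split: if_splits)

text \<open>Once \<open>b\<close> is not cancelled by \<open>Z\<close>, each letter further left is
  blocked from \<open>Z\<close> by its right neighbour, with which it neither commutes nor
  cancels.\<close>

lemma chain_foldr_act:
  assumes "chain (c @ [b])" "pull (inv_letter b) Z = None"
  shows "foldr act (c @ [b]) Z = c @ [b] @ Z"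
  using assms
proof (induction c)
  case (Cons a c)
  then obtain d e where "c @ [b] = d # e" by (cases c) auto
  then have "chain (c @ [b])" "\<not> E (fst a) (fst d)" "d \<noteq> inv_letter a"
    using Cons.prems(1) by (simp_all add: chain_Cons)
  moreover have "c @ [b] @ Z = d # e @ Z" using \<open>c @ [b] = d # e\<close> by (metis append_Cons append_assoc)
  ultimately have "pull (inv_letter a) (c @ [b] @ Z) = None" by (metis inv_letter_simps(1) pull.simps(2))
  then show ?case using Cons.IH[OF \<open>chain (c @ [b])\<close> Cons.prems(2)] by (simp add: act_def)
qed (simp add: act_def)

text \<open>A letter of \<open>R\<close> could reach the front only by commuting with letters over
  all vertices, among them its own; but no vertex is adjacent to itself.\<close>

lemma chain_full_pull:
  assumes "chain (f # c)" "V \<subseteq> fst ` set (f # c)" "R \<in> wds" "pull a ((f # c) @ R) \<noteq> None"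
  shows "a = f"
proof (cases "pull a (f # c)")
  case None
  then have all: "\<forall>x\<in>set (f # c). E (fst a) (fst x)" and "pull a R \<noteq> None"
    using assms(4) unfolding pull_append by (auto split: if_splits)
  then have "fst a \<in> V" using pull_in_set[of a R] assms(3) by auto
  then show ?thesis using all assms(2) by fastforce
qed (use chain_pull[OF assms(1)] in auto)

text \<open>Reading from the right, u meets its inverse at the front of z and nothing of u survives.\<close>

definition absorbed :: "('v \<times> bool) list \<Rightarrow> ('v \<times> bool) list \<Rightarrow> bool" where
  "absorbed u z \<longleftrightarrow> glen (u @ z) + length u = glen z"

text \<open>The word \<open>inv_word u @ nf (u @ z)\<close> represents the same element as
  \<open>z\<close> and has the length of its normal form, so it is reduced itself.\<close>

lemma absorbedD:
  assumes "absorbed u z" "u \<in> wds" "z \<in> wds"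
  shows "\<exists>w. teq (nf z) (inv_word u @ w)"
proof -
  let ?w = "nf (u @ z)"
  have w: "?w \<in> wds" using assms by (simp add: nf_in_lists)
  have c: "cls (inv_word u @ ?w) = cls z"
  proof -
    have "cls (inv_word u @ ?w) = cls (inv_word u @ (u @ z))"
      by (rule cls_append[OF HOL.refl cls_nf]) (use assms w in simp_all)
    then show ?thesis using assms cls_inv_cancel' by simp
  qed
  then have "glen (inv_word u @ ?w) = length (inv_word u @ ?w)"
    using assms(1) glen_cong[OF c] by (simp add: absorbed_def glen_def)
  then have "nf (inv_word u @ ?w) = inv_word u @ ?w" by (simp add: reduced_iff_glen nf_reduced)
  then show ?thesis using nf_cong[OF c] teq_sym by metis
qed

text \<open>Letters of \<open>u\<close> act from the right. \<open>b\<close> ends with the first of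
  them that is not cancelled; everything to its left survives because \<open>u\<close> is a
  chain.\<close>

lemma not_absorbed:
  assumes "chain u" "\<not> absorbed u z"
  obtains b c y where "u = b @ c" "b \<noteq> []" "foldr act u (nf z) = b @ y" "pull (inv_letter (last b)) y = None"
  using assms
proof (induction u arbitrary: thesis)
  case Nil
  then show ?case by (simp add: absorbed_def)
next
  case (Cons a u)
  let ?y = "foldr act u (nf z)"
  show ?case
  proof (cases "absorbed u z")
    \<comment> \<open>Here \<open>a\<close> is the first surviving letter: one more cancellation
      would make \<open>a # u\<close> absorbed.\<close>
    case True
    then have "length ?y + length u = glen z" by (simp add: absorbed_def glen_def nf_append)
    then have "pull (inv_letter a) ?y = None"
      using Cons.prems(3) pull_SomeD[of "inv_letter a" ?y, THEN teq_length]
      by (auto simp: absorbed_def glen_def nf_append act_def split: option.splits)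
    then have "act a ?y = a # ?y" "pull (inv_letter a) ?y = None" by (simp_all add: act_def)
    then show ?thesis by (intro Cons.prems(1)[of "[a]" u ?y]) simp_all
  next
    case False
    moreover have "chain u" using Cons.prems(2) chain_append[of "[a]" u] by simp
    ultimately obtain b c y where b: "u = b @ c" "b \<noteq> []" "?y = b @ y" "pull (inv_letter (last b)) y = None"
      using Cons.IH by metis
    then have "act a (b @ y) = a # b @ y"
      using Cons.prems(2) by (cases b) (auto simp: chain_Cons act_def)
    with b show ?thesis by (intro Cons.prems(1)[of "a # b" c y]) auto
  qed
qed

text \<open>One surviving letter of \<open>u\<close> shields the whole chain to its left, including
  all of \<open>c\<close>.\<close>

lemma nf_chain_not_absorbed:
  assumes "chain (c @ u)" "\<not> absorbed u z"
  obtains y where "nf (c @ u @ z) = c @ y"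
proof -
  have cu: "chain u" using assms(1) chain_append by blast
  obtain b d y where b: "u = b @ d" "b \<noteq> []" "foldr act u (nf z) = b @ y" "pull (inv_letter (last b)) y = None"
    using not_absorbed[OF cu assms(2)] .
  obtain b' l where bl: "b = b' @ [l]" using b(2) by (metis append_butlast_last_id)
  have "chain ((c @ b') @ [l])" "chain (b' @ [l])"
    using assms(1) b(1) bl chain_append[of "c @ b" d] chain_append[of c b] by auto
  then have "foldr act (c @ b) y = c @ b @ y" "foldr act b y = b @ y"
    using chain_foldr_act[of "c @ b'" l y] chain_foldr_act[of b' l y] b(4) bl by auto
  then have "nf (c @ u @ z) = c @ b @ y"
    using b(3) by (simp add: nf_append)
  then show ?thesis using that by blast
qed

end

subsection \<open>Cut points\<close>

text \<open>P spells a closed walk in the complement graph of Gamma that visits all vertices.\<close>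

locale raag_cut = raag +
  fixes a b :: 'a and P :: "('a \<times> bool) list"
  assumes ab: "a \<noteq> b" "\<not> E a b" "a \<in> V" "b \<in> V"
    and P: "chain P" "P \<noteq> []" "hd P = (a, True)" "last P = (a, True)" "fst ` set P = V" "snd ` set P \<subseteq> {True}"
begin

text \<open>A word cannot begin with two different markers: all have length 5, and their letters a and b
  do not commute.\<close>

definition marker :: "nat \<Rightarrow> ('a \<times> bool) list" where
  "marker i = replicate i (a, True) @ (b, True) # replicate (4 - i) (a, True)"

text \<open>The cut is made in the middle copy of \<open>P\<close>, at a vertex depending on the
  join; the outer copies ensure that the chains leaving it in both directions visit all
  vertices.\<close>

definition block :: "nat \<Rightarrow> ('a \<times> bool) list" where
  "block i = marker i @ (P @ P @ P) @ marker i"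

lemma P_wds [simp]: "P \<in> wds"
  unfolding P(5)[symmetric] by (auto intro: rev_image_eqI)

lemma marker_wds [simp]: "marker i \<in> wds"
  using ab by (auto simp: marker_def)

lemma block_wds [simp]: "block i \<in> wds"
  by (auto simp: block_def simp del: in_lists_conv_set)

lemma chain_replicate: "chain (replicate n (x, c))"
  by (induction n) (auto simp: chain_def successively_Cons hd_replicate)

lemma chain_marker: "chain (marker i)"
proof -
  have "chain ((b, True) # replicate n (a, True))" for n
    using ab E_sym[of b a] chain_replicate[of n a True] by (cases n) (auto simp: chain_Cons chain_single)
  then show ?thesis
    using ab chain_replicate[of i a True] by (auto simp: marker_def chain_append)
qed

lemma hd_last_marker: "hd (marker i) \<in> {(a, True), (b, True)}" "last (marker i) \<in> {(a, True), (b, True)}"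
  by (auto simp: marker_def hd_append)

lemma marker_ne [simp]: "marker i \<noteq> []"
  by (simp add: marker_def)

lemma chain_PP: "chain (P @ P)"
  using P by (simp add: chain_append)

text \<open>The letters at the junction are positive and lie over \<open>a\<close> or
  \<open>b\<close>, hence they neither cancel nor commute.\<close>

lemma chain_P_marker: "chain (P @ marker i)"
proof -
  have "\<not> E a (fst (hd (marker i)))" "snd (hd (marker i))"
    using hd_last_marker(1)[of i] ab(2) by auto
  moreover have "\<not> snd (inv_letter (last P))" using P(4) by simp
  ultimately show ?thesis
    unfolding chain_append using P(1,4) chain_marker[of i] by (metis fst_conv)
qed

lemma chain_marker_P: "chain (marker i @ P)"
proof -
  have "\<not> E (fst (last (marker i))) a" "\<not> snd (inv_letter (last (marker i)))"
    using hd_last_marker(2)[of i] ab(2) E_sym[of b a] by auto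
  moreover have "snd (hd P)" using P(3) by simp
  ultimately show ?thesis
    unfolding chain_append using P(1,3) chain_marker[of i] by (metis fst_conv)
qed

lemma marker_inj: "i < 5 \<Longrightarrow> j < 5 \<Longrightarrow> marker i = marker j \<Longrightarrow> i = j"
proof -
  have *: "takeWhile (\<lambda>x. x = (a, True)) (marker i) = replicate i (a, True)" for i
    using ab by (subst marker_def, subst takeWhile_append2) auto
  assume "marker i = marker j"
  then show ?thesis using *[of i] *[of j] by (metis length_replicate)
qed

abbreviation sees :: "'a \<times> bool \<Rightarrow> bool" where
  "sees x \<equiv> fst x = a \<or> fst x = b"

lemma filter_marker [simp]: "filter sees (marker i) = marker i" "filter sees (inv_word (marker i)) = inv_word (marker i)"
  by (auto simp: marker_def inv_word_def filter_id_conv)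

lemma filter_sees_teq: "teq u w \<Longrightarrow> filter sees u = filter sees w"
  by (rule teq_filter) (use ab E_sym in auto)

lemma length_marker: "i < 5 \<Longrightarrow> length (marker i) = 5"
  by (simp add: marker_def)

text \<open>Both inverse markers begin the normal form of \<open>z\<close>, but only up to shuffles.
  Keeping just the letters over \<open>a\<close> and \<open>b\<close> turns them into literal
  prefixes of length 5 of one word.\<close>

lemma absorbed_marker_unique:
  assumes "absorbed (marker i) z" "absorbed (marker j) z" "i < 5" "j < 5" "z \<in> wds"
  shows "i = j"
proof -
  obtain u w where "teq (nf z) (inv_word (marker i) @ u)" "teq (nf z) (inv_word (marker j) @ w)"
    using absorbedD[OF assms(1) marker_wds assms(5)] absorbedD[OF assms(2) marker_wds assms(5)] by blast
  from this[THEN filter_sees_teq]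
  have "inv_word (marker i) @ filter sees u = inv_word (marker j) @ filter sees w" by simp
  then have "inv_word (marker i) = inv_word (marker j)" using assms by (simp add: length_marker)
  then have "marker i = marker j" by (metis inv_word_simps(4))
  then show ?thesis using assms marker_inj by blast
qed

lemma absorbed_inv_marker_unique:
  assumes "absorbed (inv_word (marker i)) z" "absorbed (inv_word (marker j)) z" "i < 5" "j < 5" "z \<in> wds"
  shows "i = j"
proof -
  have "inv_word (marker i) \<in> wds" for i by simp
  then obtain u w where "teq (nf z) (marker i @ u)" "teq (nf z) (marker j @ w)"
    using assms absorbedD by (metis inv_word_simps(4))
  from this[THEN filter_sees_teq]
  have "marker i @ filter sees u = marker j @ filter sees w" by simp
  then have "marker i = marker j" using assms by (simp add: length_marker)
  then show ?thesis using assms marker_inj by blast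
qed

text \<open>Needed so that the five step sequences spelling the blocks are distinct. Blocks are
  chains, hence reduced, so their classes determine them up to shuffles.\<close>

lemma cls_block_inj:
  assumes "cls (block i) = cls (block j)" "i < 5" "j < 5"
  shows "i = j"
proof -
  have "chain (marker i @ P @ P @ P @ marker i)" for i
    using chain_PP chain_P_marker[of i] chain_marker_P[of i] P(2) by (auto simp: chain_append)
  then have "reduced (block i)" for i
  proof -
    have "chain w \<Longrightarrow> reduced w" for w
    proof (induction w)
      case (Cons x w)
      then show ?case using chain_pull[of "hd w" "tl w" "inv_letter x"]
        by (cases w) (auto simp: chain_Cons split: option.splits)
    qed simp
    then show ?thesis using \<open>\<And>i. chain (marker i @ P @ P @ P @ marker i)\<close> by (simp add: block_def)
  qed
  then have "teq (block i) (block j)" using nf_cong[OF assms(1)] nf_reduced by metis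
  from filter_sees_teq[OF this] have "marker i = marker j"
    using assms by (simp add: block_def length_marker)
  then show ?thesis using assms marker_inj by blast
qed

text \<open>Bounds the way from the start of a block to the cut: the marker, one copy of
  \<open>P\<close> and a part of the next.\<close>

definition cut_radius :: nat where
  "cut_radius = length P + length P + 5"

text \<open>The cut is chosen after the join: a vertex \<open>s\<close> outside \<open>S\<close>
  occurs in the middle \<open>P\<close>, and the cut is placed just before it. By \<open>L\<close>
  and \<open>R\<close> the chains on both sides survive in the normal forms of the ways to the two
  endpoints, so \<open>gate_cut\<close> applies.\<close>

lemma block_gate:
  assumes X: "X \<in> wds" and Y: "Y \<in> wds" and i: "i < 5"
    and L: "\<not> absorbed (inv_word (marker i)) (inv_word X)"
    and R: "\<not> absorbed (marker i) Y"
    and g: "g \<in> wds" and S: "S \<subset> V"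
  defines "K \<equiv> raag_coset V E (cls g) S"
  shows "\<exists>r\<in>wds. length r \<le> cut_radius \<and>
    gate V E K (cls (X @ r)) \<in> {gate V E K (cls []), gate V E K (cls (X @ block i @ Y))}"
proof -
  obtain s where s: "s \<in> V" "s \<notin> S" using S by blast
  then have "(s, True) \<in> set P" using P(5,6) by force
  then obtain p1 p2 where p: "P = p1 @ (s, True) # p2" by (metis split_list)
  have pw: "p1 \<in> wds" "(s, True) # p2 \<in> wds" using P_wds unfolding p by auto
  let ?r = "marker i @ P @ p1"
  let ?c = "(s, True) # p2 @ P" and ?d = "inv_word p1 @ inv_word P"
  have rw: "?r \<in> wds" and lr: "length ?r \<le> cut_radius"
    using pw i arg_cong[OF p, of length] by (auto simp: cut_radius_def length_marker simp del: in_lists_conv_set)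
  have chPP: "chain (P @ P @ marker i)" "chain (marker i @ P @ P)"
    using chain_PP chain_P_marker[of i] chain_marker_P[of i] P(2) by (auto simp: chain_append)
  then have c: "chain (?c @ marker i)" using chain_append[of p1 "?c @ marker i"] p by simp
  have "chain (?r @ (s, True) # p2)" using chPP(2) p by simp
  then have d0: "chain ?r" using chain_append[of ?r] by blast
  then have d: "chain (?d @ inv_word (marker i))" using chain_inv[of ?r] by simp
  obtain y where y: "nf (?c @ marker i @ Y) = ?c @ y"
    using nf_chain_not_absorbed[OF c R] .
  obtain x where x: "nf (?d @ inv_word (marker i) @ inv_word X) = ?d @ x"
    using nf_chain_not_absorbed[OF d L] .
  let ?u = "?c @ y" and ?v = "?d @ x"
  have uw: "?u \<in> wds" unfolding y[symmetric] using pw Y by (intro nf_in_lists) (simp del: in_lists_conv_set)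
  have vw: "?v \<in> wds" unfolding x[symmetric] using pw X by (intro nf_in_lists) (simp del: in_lists_conv_set)
  have P': "inv_word P \<noteq> []" using P by simp
  have dne: "?d \<noteq> []" using P' by blast
  obtain f' d' where fd: "?d = f' # d'" using dne by (cases ?d) auto
  \<comment> \<open>The backward word starts with the inverse of the letter preceding the cut; if
    \<open>p1\<close> is empty, that is the last letter of the first \<open>P\<close>.\<close>
  have last_f: "f' = inv_letter (last (P @ p1))"
  proof -
    have "P @ p1 = inv_word ?d" by simp
    also have "\<dots> = inv_word d' @ [inv_letter f']" unfolding fd by simp
    finally show ?thesis by simp
  qed
  have "chain ((P @ p1) @ (s, True) # p2)" using chain_PP p by simp
  then have nE: "\<not> E (fst (last (P @ p1))) s" using P(2) unfolding chain_append by simp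
  have "last (P @ p1) \<in> set P" using P(2) last_in_set[of "P @ p1"] unfolding p by auto
  then have pos: "snd (last (P @ p1))" using P(6) by auto
  have q: "gate V E K (cls ((X @ ?r) @ ?u)) = gate V E K (cls (X @ ?r)) \<or>
    gate V E K (cls ((X @ ?r) @ ?v)) = gate V E K (cls (X @ ?r))"
    unfolding K_def
  proof (rule gate_cut)
    show "reduced ?u" "reduced ?v" using reduced_nf x y by metis+
    show "h = (s, True)" if "pull h ?u \<noteq> None" for h
    proof (rule chain_full_pull)
      show "chain ((s, True) # p2 @ P)" using c chain_append[of ?c] by simp
      show "y \<in> wds" using uw by simp
      show "pull h (((s, True) # p2 @ P) @ y) \<noteq> None" using that by simp
    qed (use P(5) in auto)
    show "h = f'" if "pull h ?v \<noteq> None" for h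
    proof (rule chain_full_pull)
      show "chain (f' # d')" using d chain_append[of ?d] fd by simp
      show "x \<in> wds" using vw by simp
      show "pull h ((f' # d') @ x) \<noteq> None" using that fd by simp
      have "fst ` set (f' # d') \<supseteq> fst ` set (inv_word P)" unfolding fd[symmetric] by auto
      also have "fst ` set (inv_word P) = V" using P(5) by (simp add: inv_word_def image_image)
      finally show "V \<subseteq> fst ` set (f' # d')" .
    qed
    \<comment> \<open>All letters of \<open>P\<close> are positive, so \<open>f'\<close>, the
      inverse of one of them, is negative.\<close>
    show "(s, True) \<noteq> f'" using pos unfolding last_f by (cases "last (P @ p1)") auto
    show "\<not> E (fst (s, True)) (fst f')" using nE E_sym unfolding last_f by auto
  qed (use uw vw g S s X rw in auto)
  have "cls ((X @ ?r) @ ?u) = cls ((X @ ?r) @ (?c @ marker i @ Y))"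
    unfolding y[symmetric] by (rule cls_append[OF HOL.refl cls_nf]) (use X Y rw pw uw y in \<open>auto simp del: in_lists_conv_set\<close>)
  also have "(X @ ?r) @ (?c @ marker i @ Y) = X @ block i @ Y"
    unfolding block_def by (simp add: p)
  finally have e1: "cls ((X @ ?r) @ ?u) = cls (X @ block i @ Y)" .
  have "cls ((X @ ?r) @ ?v) = cls ((X @ ?r) @ (inv_word (X @ ?r) @ []))"
    unfolding x[symmetric] by (rule cls_append[OF HOL.refl]) (use X rw pw vw x cls_nf[of "inv_word (X @ ?r)"] in \<open>auto simp del: in_lists_conv_set\<close>)
  also have "\<dots> = cls []" by (rule cls_inv_cancel) (use X rw in auto)
  finally have e2: "cls ((X @ ?r) @ ?v) = cls []" .
  show ?thesis using q rw lr unfolding e1 e2 by (intro bexI[of _ ?r]) auto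
qed

end

subsection \<open>Blocks without a cut\<close>

text \<open>The values 2 and 1/2 are reciprocal, so a block of \<open>T\<close> that is bad on at
  least one side has two weights with product at least 1.\<close>

definition block_weight :: "'b set \<Rightarrow> bool \<Rightarrow> 'b \<Rightarrow> real" where
  "block_weight T bad x = (if x \<in> T then if bad then 2 else 1 / 2 else 1)"

text \<open>As at most one of the five blocks of T is bad, the mean weight of a block is at most
  1 - 5p + 2p + 4p/2 = 1 - p, and it is multiplicative when the past (or the future) is exposed block by
  block.  If every block of T is bad for the past or for the future, the product of the two weights
  is at least 1.\<close>

primrec past_weight :: "'c list set \<Rightarrow> ('c list \<Rightarrow> 'c list \<Rightarrow> bool) \<Rightarrow> 'c list \<Rightarrow> 'c list list \<Rightarrow> real" where
  "past_weight T L h [] = 1"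
| "past_weight T L h (x # xs) = block_weight T (L h x) x * past_weight T L (h @ x) xs"

primrec future_weight :: "'c list set \<Rightarrow> ('c list \<Rightarrow> 'c list \<Rightarrow> bool) \<Rightarrow> 'c list list \<Rightarrow> 'c list \<Rightarrow> real" where
  "future_weight T R [] y = 1"
| "future_weight T R (x # xs) y = block_weight T (R (concat xs @ y) x) x * future_weight T R xs y"

lemma block_weight_pos [simp]: "block_weight T bad x > 0" "block_weight T bad x \<ge> 0"
  by (auto simp: block_weight_def)

lemma past_weight_pos [simp]: "past_weight T L h xs > 0"
  by (induction xs arbitrary: h) auto

lemma future_weight_pos [simp]: "future_weight T R xs y > 0"
  by (induction xs) auto

lemma weight_product:
  assumes "\<And>us x vs. xs = us @ x # vs \<Longrightarrow> x \<in> T \<Longrightarrow> L (h @ concat us) x \<or> R (concat vs @ y) x"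
  shows "past_weight T L h xs * future_weight T R xs y \<ge> 1"
  using assms
proof (induction xs arbitrary: h)
  case (Cons x xs)
  have 1: "past_weight T L (h @ x) xs * future_weight T R xs y \<ge> 1"
  proof (rule Cons.IH)
    fix us z vs assume "xs = us @ z # vs" "z \<in> T"
    then show "L ((h @ x) @ concat us) z \<or> R (concat vs @ y) z" using Cons.prems[of "x # us" z vs] by simp
  qed
  have 2: "block_weight T (L h x) x * block_weight T (R (concat xs @ y) x) x \<ge> 1"
    using Cons.prems[of "[]" x xs] by (auto simp: block_weight_def)
  have "1 * 1 \<le> (block_weight T (L h x) x * block_weight T (R (concat xs @ y) x) x) *
      (past_weight T L (h @ x) xs * future_weight T R xs y)"
    by (rule mult_mono[OF 2 1]) (auto intro: mult_nonneg_nonneg)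
  then show ?case by (simp add: mult_ac)
qed simp

lemma block_weight_mean:
  fixes B :: "'b pmf"
  assumes T: "finite T" "card T = 5" "\<And>x. x \<in> T \<Longrightarrow> pmf B x = p"
    and bad: "\<And>x y. x \<in> T \<Longrightarrow> y \<in> T \<Longrightarrow> bad x \<Longrightarrow> bad y \<Longrightarrow> x = y"
  shows "(\<integral>\<^sup>+x. ennreal (block_weight T (bad x) x) \<partial>measure_pmf B) \<le> ennreal (1 - p)"
proof -
  let ?D = "{x \<in> T. bad x}"
  have "card ?D \<le> 1"
    using T(1) bad by (subst card_le_Suc0_iff_eq[unfolded One_nat_def[symmetric]]) auto
  have fin: "finite ?D" using T(1) by simp
  have pm: "measure_pmf.prob B S = real (card S) * p" if "S \<subseteq> T" for S
  proof -
    have "measure_pmf.prob B S = (\<Sum>x\<in>S. pmf B x)"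
      using finite_subset[OF that T(1)] by (rule measure_measure_pmf_finite)
    then show ?thesis using T(3) that by (simp add: subset_iff)
  qed
  have p0: "p \<ge> 0" using T(2,3) by (metis card.empty ex_in_conv pmf_nonneg zero_neq_numeral)
  have le: "real (card T) * p \<le> 1" using pm[of T] measure_pmf.prob_le_1[of B T] by simp
  \<comment> \<open>Relative to 1, a block of \<open>T\<close> loses 1/2 and a bad one gains 3/2
    back; as there is at most one bad block, the mean is at most 1 - 5p/2 + 3p/2.\<close>
  have "block_weight T (bad x) x + 1/2 * indicator T x = 1 + 3/2 * indicator ?D x" for x
    by (auto simp: block_weight_def)
  then have w: "ennreal (block_weight T (bad x) x) =
      ennreal (1 - 1/2 * indicator T x + 3/2 * indicator ?D x)" for x
    by (intro arg_cong[where f = ennreal]) (smt (verit))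
  have i: "integrable (measure_pmf B) (\<lambda>x. c * indicator S x :: real)" for c S
    by (intro measure_pmf.integrable_const_bound[where B = "\<bar>c\<bar>"]) (auto simp: indicator_def)
  have int: "integrable (measure_pmf B) (\<lambda>x. 1 - 1/2 * indicator T x + 3/2 * indicator ?D x :: real)"
    by (intro measure_pmf.integrable_const_bound[where B = 3]) (auto simp: indicator_def)
  have "(\<integral>\<^sup>+x. ennreal (block_weight T (bad x) x) \<partial>measure_pmf B)
      = ennreal (\<integral>x. 1 - 1/2 * indicator T x + 3/2 * indicator ?D x \<partial>measure_pmf B)"
    unfolding w by (rule nn_integral_eq_integral[OF int]) (auto simp: indicator_def)
  also have "(\<integral>x. 1 - 1/2 * indicator T x + 3/2 * indicator ?D x \<partial>measure_pmf B)
      = 1 - 1/2 * measure_pmf.prob B T + 3/2 * measure_pmf.prob B ?D"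
    using i[of "1/2" T] i[of "3/2" ?D] by simp
  also have "\<dots> = 1 - 5/2 * p + 3/2 * (real (card ?D) * p)" using pm[of T] pm[of ?D] T(2) by simp
  also have "ennreal (1 - 5/2 * p + 3/2 * (real (card ?D) * p)) \<le> ennreal (1 - p)"
  proof (rule ennreal_leI)
    have "real (card ?D) * p \<le> 1 * p" using \<open>card ?D \<le> 1\<close> p0 by (intro mult_right_mono) auto
    then show "1 - 5/2 * p + 3/2 * (real (card ?D) * p) \<le> 1 - p" by simp
  qed
  finally show ?thesis .
qed

context
  fixes B :: "'c list pmf" and T :: "'c list set" and p :: real
  assumes T: "finite T" "card T = 5" "\<And>x. x \<in> T \<Longrightarrow> pmf B x = p"
begin

text \<open>The weight of a block depends only on the history before it, so averaging over the first
  block leaves the same problem with a longer history; the induction therefore keeps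
  \<open>h\<close> arbitrary.\<close>

lemma past_weight_mean:
  assumes "\<And>h x y. x \<in> T \<Longrightarrow> y \<in> T \<Longrightarrow> L h x \<Longrightarrow> L h y \<Longrightarrow> x = y"
  shows "(\<integral>\<^sup>+xs. ennreal (past_weight T L h xs) \<partial>measure_pmf (replicate_pmf m B)) \<le> ennreal (1 - p) ^ m"
proof (induction m arbitrary: h)
  case 0
  then show ?case by (simp add: nn_integral_return_pmf)
next
  case (Suc m)
  have "(\<integral>\<^sup>+xs. ennreal (past_weight T L h xs) \<partial>measure_pmf (replicate_pmf (Suc m) B)) =
    (\<integral>\<^sup>+x. ennreal (block_weight T (L h x) x) *
      (\<integral>\<^sup>+xs. ennreal (past_weight T L (h @ x) xs) \<partial>measure_pmf (replicate_pmf m B)) \<partial>measure_pmf B)"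
    by (simp add: nn_integral_return_pmf ennreal_mult' nn_integral_cmult)
  also have "\<dots> \<le> (\<integral>\<^sup>+x. ennreal (block_weight T (L h x) x) * ennreal (1 - p) ^ m \<partial>measure_pmf B)"
    by (intro nn_integral_mono mult_left_mono Suc.IH) simp
  also have "\<dots> = (\<integral>\<^sup>+x. ennreal (block_weight T (L h x) x) \<partial>measure_pmf B) * ennreal (1 - p) ^ m"
    by (simp add: nn_integral_multc)
  also have "\<dots> \<le> ennreal (1 - p) * ennreal (1 - p) ^ m"
    by (intro mult_right_mono block_weight_mean[OF T]) (use assms in auto)
  finally show ?case by simp
qed

text \<open>Here the weight of the first block depends on all later ones, so the order of sampling
  is exchanged and the later blocks are fixed before the first is averaged.\<close>

lemma future_weight_mean:
  assumes "\<And>h x y. x \<in> T \<Longrightarrow> y \<in> T \<Longrightarrow> R h x \<Longrightarrow> R h y \<Longrightarrow> x = y"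
  shows "(\<integral>\<^sup>+xs. ennreal (future_weight T R xs y) \<partial>measure_pmf (replicate_pmf m B)) \<le> ennreal (1 - p) ^ m"
proof (induction m)
  case 0
  then show ?case by (simp add: nn_integral_return_pmf)
next
  case (Suc m)
  have c: "replicate_pmf (Suc m) B = replicate_pmf m B \<bind> (\<lambda>xs. B \<bind> (\<lambda>x. return_pmf (x # xs)))"
    by (simp add: bind_commute_pmf[of B])
  have "(\<integral>\<^sup>+xs. ennreal (future_weight T R xs y) \<partial>measure_pmf (replicate_pmf (Suc m) B)) =
    (\<integral>\<^sup>+xs. (\<integral>\<^sup>+x. ennreal (block_weight T (R (concat xs @ y) x) x) \<partial>measure_pmf B) *
      ennreal (future_weight T R xs y) \<partial>measure_pmf (replicate_pmf m B))"
    unfolding c by (simp add: nn_integral_return_pmf ennreal_mult' nn_integral_multc less_imp_le)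
  also have "\<dots> \<le> (\<integral>\<^sup>+xs. ennreal (1 - p) * ennreal (future_weight T R xs y) \<partial>measure_pmf (replicate_pmf m B))"
    by (intro nn_integral_mono mult_right_mono block_weight_mean[OF T]) (use assms in auto)
  also have "\<dots> = ennreal (1 - p) * (\<integral>\<^sup>+xs. ennreal (future_weight T R xs y) \<partial>measure_pmf (replicate_pmf m B))"
    by (simp add: nn_integral_cmult)
  also have "\<dots> \<le> ennreal (1 - p) * ennreal (1 - p) ^ m"
    by (intro mult_left_mono Suc.IH) simp
  finally show ?case by simp
qed

text \<open>When all blocks of \<open>T\<close> fail, one of the two weights is at least 1, so the
  indicator is at most their sum. The sum decouples: the past weight does not involve
  \<open>y\<close>, the future weight does not involve \<open>h\<close>.\<close>

lemma all_blocks_bad: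
  fixes A C :: "'c list pmf"
  assumes L: "\<And>h x y. x \<in> T \<Longrightarrow> y \<in> T \<Longrightarrow> L h x \<Longrightarrow> L h y \<Longrightarrow> x = y"
    and R: "\<And>h x y. x \<in> T \<Longrightarrow> y \<in> T \<Longrightarrow> R h x \<Longrightarrow> R h y \<Longrightarrow> x = y"
    and Z: "\<And>h xs y. h \<in> set_pmf A \<Longrightarrow> xs \<in> set_pmf (replicate_pmf m B) \<Longrightarrow> y \<in> set_pmf C \<Longrightarrow>
      h @ concat xs @ y \<in> Z \<Longrightarrow>
      (\<And>us x vs. xs = us @ x # vs \<Longrightarrow> x \<in> T \<Longrightarrow> L (h @ concat us) x \<or> R (concat vs @ y) x)"
  shows "emeasure (measure_pmf (A \<bind> (\<lambda>h. replicate_pmf m B \<bind> (\<lambda>xs. C \<bind>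
      (\<lambda>y. return_pmf (h @ concat xs @ y)))))) Z \<le> 2 * ennreal (1 - p) ^ m"
proof -
  let ?B = "replicate_pmf m B"
  have ind: "indicator Z (h @ concat xs @ y) \<le> ennreal (past_weight T L h xs) + ennreal (future_weight T R xs y)"
    if "h \<in> set_pmf A" "xs \<in> set_pmf ?B" "y \<in> set_pmf C" for h xs y
  proof (cases "h @ concat xs @ y \<in> Z")
    case True
    let ?f = "past_weight T L h xs" and ?g = "future_weight T R xs y"
    have "?f * ?g \<ge> 1" by (rule weight_product) (use Z[OF that True] in blast)
    then have "?f \<ge> 1 \<or> ?g \<ge> 1"
      by (metis less_eq_real_def linorder_not_less mult_less_cancel_right1 past_weight_pos future_weight_pos order_less_le_trans)
    then have "1 \<le> ennreal (?f + ?g)"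
      using past_weight_pos[of T L h xs] future_weight_pos[of T R xs y] by (intro ennreal_ge_1[THEN iffD2]) linarith
    then show ?thesis using True by (simp add: ennreal_plus[symmetric] less_imp_le del: ennreal_plus)
  qed simp
  have "emeasure (measure_pmf (A \<bind> (\<lambda>h. ?B \<bind> (\<lambda>xs. C \<bind> (\<lambda>y. return_pmf (h @ concat xs @ y)))))) Z
    = (\<integral>\<^sup>+h. (\<integral>\<^sup>+xs. (\<integral>\<^sup>+y. indicator Z (h @ concat xs @ y) \<partial>measure_pmf C) \<partial>measure_pmf ?B) \<partial>measure_pmf A)"
    by (subst nn_integral_indicator[symmetric], simp) (simp add: nn_integral_return_pmf)
  also have "\<dots> \<le> (\<integral>\<^sup>+h. (\<integral>\<^sup>+xs. (\<integral>\<^sup>+y. ennreal (past_weight T L h xs) + ennreal (future_weight T R xs y)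
      \<partial>measure_pmf C) \<partial>measure_pmf ?B) \<partial>measure_pmf A)"
    by (intro nn_integral_mono_AE AE_pmfI ind)
  also have "\<dots> = (\<integral>\<^sup>+h. (\<integral>\<^sup>+xs. ennreal (past_weight T L h xs) \<partial>measure_pmf ?B) \<partial>measure_pmf A)
     + (\<integral>\<^sup>+xs. (\<integral>\<^sup>+y. ennreal (future_weight T R xs y) \<partial>measure_pmf C) \<partial>measure_pmf ?B)"
    by (simp add: nn_integral_add)
  \<comment> \<open>The integrals are exchanged because the mean of the future weight is bounded for
    a given \<open>y\<close>.\<close>
  also have "(\<integral>\<^sup>+xs. (\<integral>\<^sup>+y. ennreal (future_weight T R xs y) \<partial>measure_pmf C) \<partial>measure_pmf ?B)
     = (\<integral>\<^sup>+y. (\<integral>\<^sup>+xs. ennreal (future_weight T R xs y) \<partial>measure_pmf ?B) \<partial>measure_pmf C)"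
    using nn_integral_pair_pmf'[of ?B C "\<lambda>(xs, y). ennreal (future_weight T R xs y)"]
      nn_integral_pair_pmf'[of C ?B "\<lambda>(y, xs). ennreal (future_weight T R xs y)"]
    by (simp add: pair_commute_pmf[of ?B C] case_prod_beta)
  also have "(\<integral>\<^sup>+h. (\<integral>\<^sup>+xs. ennreal (past_weight T L h xs) \<partial>measure_pmf ?B) \<partial>measure_pmf A)
     + (\<integral>\<^sup>+y. (\<integral>\<^sup>+xs. ennreal (future_weight T R xs y) \<partial>measure_pmf ?B) \<partial>measure_pmf C)
     \<le> (\<integral>\<^sup>+h. ennreal (1 - p) ^ m \<partial>measure_pmf A) + (\<integral>\<^sup>+y. ennreal (1 - p) ^ m \<partial>measure_pmf C)"
    by (intro add_mono nn_integral_mono past_weight_mean future_weight_mean L R)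
  also have "\<dots> = 2 * ennreal (1 - p) ^ m" by (simp add: mult_2)
  finally show ?thesis .
qed

end

section \<open>Independent steps grouped into blocks\<close>

lemma replicate_pmf_concat: "replicate_pmf (m * N) \<mu> = map_pmf concat (replicate_pmf m (replicate_pmf N \<mu>))"
proof (induction m)
  case (Suc m)
  have "replicate_pmf (Suc m * N) \<mu> = replicate_pmf (N + m * N) \<mu>" by simp
  also have "\<dots> = map_pmf concat (replicate_pmf (Suc m) (replicate_pmf N \<mu>))"
    unfolding replicate_pmf_distrib Suc
    by (simp add: map_bind_pmf bind_map_pmf bind_return_pmf map_pmf_def bind_assoc_pmf)
  finally show ?case .
qed simp

lemma replicate_pmf_blocks:
  "replicate_pmf (t + m * N + r) \<mu> = replicate_pmf t \<mu> \<bind> (\<lambda>h. replicate_pmf m (replicate_pmf N \<mu>) \<bind>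
     (\<lambda>xs. replicate_pmf r \<mu> \<bind> (\<lambda>y. return_pmf (h @ concat xs @ y))))"
  unfolding replicate_pmf_distrib replicate_pmf_concat
  by (simp add: bind_map_pmf bind_return_pmf bind_assoc_pmf)

lemma pmf_replicate_pmf: "pmf (replicate_pmf (length xs) \<mu>) xs = prod_list (map (pmf \<mu>) xs)"
proof (induction xs)
  case (Cons x xs)
  let ?f = "\<lambda>(x, xs). x # xs"
  have "replicate_pmf (length (x # xs)) \<mu> = map_pmf ?f (pair_pmf \<mu> (replicate_pmf (length xs) \<mu>))"
    by (simp add: pair_pmf_def map_bind_pmf)
  moreover have "pmf (map_pmf ?f (pair_pmf \<mu> (replicate_pmf (length xs) \<mu>))) (?f (x, xs)) =
      pmf (pair_pmf \<mu> (replicate_pmf (length xs) \<mu>)) (x, xs)"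
    by (rule pmf_map_inj') (auto simp: inj_on_def)
  ultimately show ?case using Cons by (simp add: pmf_pair)
qed simp

subsection \<open>Cuts along the random walk\<close>

context raag
begin

definition wd :: "('v \<times> bool) list set list \<Rightarrow> ('v \<times> bool) list" where
  "wd gs = concat (map rep gs)"

lemma wd_simps [simp]: "wd [] = []" "wd (g # gs) = rep g @ wd gs" "wd (gs @ hs) = wd gs @ wd hs"
  by (simp_all add: wd_def)

lemma wd_wds: "gs \<in> lists (raag_carrier V E) \<Longrightarrow> wd gs \<in> wds"
  by (induction gs) (auto simp: cls_rep simp del: in_lists_conv_set)

lemma foldl_mult:
  "x \<in> wds \<Longrightarrow> gs \<in> lists (raag_carrier V E) \<Longrightarrow> foldl (raag_mult V E) (cls x) gs = cls (x @ wd gs)"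
proof (induction gs arbitrary: x)
  case (Cons g gs)
  have "g \<in> raag_carrier V E" using Cons.prems by simp
  then have g: "cls (rep g) = g" "rep g \<in> wds" using cls_rep by auto
  have "raag_mult V E (cls x) g = cls (x @ rep g)"
    using mult_cls[OF Cons.prems(1) g(2)] g(1) by simp
  then show ?case using Cons.IH[of "x @ rep g"] Cons.prems g(2) by (simp del: in_lists_conv_set)
qed simp

lemma walk_wd: "gs \<in> lists (raag_carrier V E) \<Longrightarrow> foldl (raag_mult V E) (raag_one V E) gs = cls (wd gs)"
  using foldl_mult[of "[]" gs] by (simp add: raag_one_def)

lemma semigroup_word:
  assumes "S \<subseteq> raag_carrier V E" "s \<in> raag_semigroup V E S"
  shows "\<exists>gs \<in> lists S. cls (wd gs) = s"
  using assms(2)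
proof induction
  case (gen s)
  then show ?case using assms(1) cls_rep by (intro bexI[of _ "[s]"]) auto
next
  case (mult x y)
  then obtain gs hs where gh: "gs \<in> lists S" "hs \<in> lists S" "cls (wd gs) = x" "cls (wd hs) = y" by blast
  then have "gs \<in> lists (raag_carrier V E)" "hs \<in> lists (raag_carrier V E)" using assms(1) by auto
  then have "cls (wd (gs @ hs)) = raag_mult V E x y"
    using gh wd_wds mult_cls[of "wd gs" "wd hs"] by simp
  then show ?case using gh by (intro bexI[of _ "gs @ hs"]) auto
qed

lemma sup_join_proj_le:
  assumes "gs \<in> lists (raag_carrier V E)"
    and "\<And>g S. g \<in> wds \<Longrightarrow> S \<subseteq> V \<Longrightarrow> is_join E S \<Longrightarrow>
      proj_dist V E (raag_coset V E (cls g) S) (cls []) (cls (wd gs)) \<le> c"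
  shows "sup_join_proj V E (raag_one V E) (foldl (raag_mult V E) (raag_one V E) gs) \<le> ereal (real c)"
  unfolding sup_join_proj_def walk_wd[OF assms(1)]
proof (rule SUP_least)
  fix K assume "K \<in> join_subcomplexes V E"
  then obtain g S where "K = raag_coset V E (cls g) S" "g \<in> wds" "S \<subseteq> V" "is_join E S"
    unfolding join_subcomplexes_def raag_carrier_def by blast
  then show "ereal (real (proj_dist V E K (raag_one V E) (cls (wd gs)))) \<le> ereal (real c)"
    using assms(2) by (simp add: raag_one_def)
qed

text \<open>A crude bound at each single time; it serves the finitely many times before the
  logarithmic bound takes over on a sample path.\<close>

lemma sup_join_proj_finite:
  assumes "gs \<in> lists (raag_carrier V E)"
  shows "sup_join_proj V E (raag_one V E) (foldl (raag_mult V E) (raag_one V E) gs) \<le> ereal (real (length (wd gs)))"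
  using sup_join_proj_le[OF assms] proj_dist_append[of _ _ "[]" "wd gs"] wd_wds[OF assms] by simp

end

section \<open>Blocks spelled by steps of the walk\<close>

locale raag_walk = raag_cut +
  fixes \<mu> :: "('a \<times> bool) list set pmf"
  assumes not_join: "\<not> is_join E V"
    and finite_support: "finite (set_pmf \<mu>)"
    and support: "set_pmf \<mu> \<subseteq> raag_carrier V E"
    and generating: "raag_semigroup V E (set_pmf \<mu>) = raag_carrier V E"
begin

text \<open>One fixed product of support elements for each letter. Spelling letter by letter turns
  permuted words into step sequences of the same length and probability.\<close>

definition spell :: "'a \<times> bool \<Rightarrow> ('a \<times> bool) list set list" where
  "spell x = (SOME gs. gs \<in> lists (set_pmf \<mu>) \<and> cls (wd gs) = cls [x])"

definition spelled :: "('a \<times> bool) list \<Rightarrow> ('a \<times> bool) list set list" where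
  "spelled w = concat (map spell w)"

definition tau :: "nat \<Rightarrow> ('a \<times> bool) list set list" where
  "tau i = spelled (block i)"

abbreviation "N \<equiv> length (tau 0)"

definition prb :: real where
  "prb = pmf (replicate_pmf N \<mu>) (tau 0)"

lemma support_lists: "gs \<in> lists (set_pmf \<mu>) \<Longrightarrow> gs \<in> lists (raag_carrier V E)"
  using support by auto

lemma spell:
  assumes "x \<in> V \<times> UNIV"
  shows "spell x \<in> lists (set_pmf \<mu>)" "cls (wd (spell x)) = cls [x]"
proof -
  have "[x] \<in> wds" using assms by simp
  then have "cls [x] \<in> raag_semigroup V E (set_pmf \<mu>)" unfolding generating raag_carrier_def by (rule imageI)
  then have "\<exists>gs. gs \<in> lists (set_pmf \<mu>) \<and> cls (wd gs) = cls [x]" using semigroup_word[OF support] by blast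
  then have "spell x \<in> lists (set_pmf \<mu>) \<and> cls (wd (spell x)) = cls [x]" unfolding spell_def by (rule someI_ex)
  then show "spell x \<in> lists (set_pmf \<mu>)" "cls (wd (spell x)) = cls [x]" by auto
qed

lemma spelled: "w \<in> wds \<Longrightarrow> spelled w \<in> lists (set_pmf \<mu>) \<and> cls (wd (spelled w)) = cls w"
proof (induction w)
  case (Cons x w)
  have x: "x \<in> V \<times> UNIV" and w: "w \<in> wds" using Cons.prems by auto
  have s: "spelled (x # w) = spell x @ spelled w" by (simp add: spelled_def)
  have "cls (wd (spell x) @ wd (spelled w)) = cls ([x] @ w)"
    using Cons.IH[OF w] spell[OF x] wd_wds support_lists x w by (intro cls_append) auto
  then show ?case unfolding s using Cons.IH[OF w] spell[OF x] by simp
qed (simp add: spelled_def)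

lemma tau: "tau i \<in> lists (set_pmf \<mu>)" "cls (wd (tau i)) = cls (block i)"
  using spelled[of "block i"] by (simp_all add: tau_def del: in_lists_conv_set)

lemma mset_block: "i < 5 \<Longrightarrow> mset (block i) = mset (block 0)"
proof -
  assume "i < 5"
  then have "replicate_mset i x + replicate_mset (4 - i) x = replicate_mset 4 x" for x :: "'a \<times> bool"
    by (simp add: multiset_eq_iff)
  then have "mset (marker i) = mset (marker 0)" by (simp add: marker_def)
  then show ?thesis by (simp add: block_def)
qed

lemma length_tau: "i < 5 \<Longrightarrow> length (tau i) = N"
proof -
  assume i: "i < 5"
  have *: "length (tau j) = sum_mset (image_mset (\<lambda>x. length (spell x)) (mset (block j)))" for j
    by (simp add: tau_def spelled_def length_concat o_def sum_mset_sum_list flip: mset_map)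
  show ?thesis unfolding * mset_block[OF i] ..
qed

lemma pmf_tau: "i < 5 \<Longrightarrow> pmf (replicate_pmf N \<mu>) (tau i) = prb"
proof -
  assume i: "i < 5"
  have "prod_list (map (pmf \<mu>) (spelled w)) = prod_mset (image_mset (\<lambda>x. prod_list (map (pmf \<mu>) (spell x))) (mset w))" for w
    by (induction w) (auto simp: spelled_def)
  then have *: "pmf (replicate_pmf (length (tau j)) \<mu>) (tau j) =
      prod_mset (image_mset (\<lambda>x. prod_list (map (pmf \<mu>) (spell x))) (mset (block j)))" for j
    unfolding pmf_replicate_pmf tau_def .
  show ?thesis unfolding prb_def *[of 0] using *[of i] unfolding length_tau[OF i] mset_block[OF i] .
qed

lemma prb: "0 < prb" "prb \<le> 1"
proof -
  have "tau 0 \<in> set_pmf (replicate_pmf N \<mu>)" using tau(1)[of 0] by (auto simp: set_replicate_pmf)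
  then show "0 < prb" unfolding prb_def by (rule pmf_positive)
qed (simp add: prb_def pmf_le_1)

lemma tau_inj: "inj_on tau {..<5}"
  by (intro inj_onI) (metis cls_block_inj lessThan_iff tau(2))

text \<open>Seen from the block, the way back to the identity is the inverse marker followed by the
  inverse of the past. The membership clause gives \<open>past_bad_unique\<close> for arbitrary
  \<open>h\<close>, the form in which \<open>all_blocks_bad\<close> asks for it.\<close>

definition past_bad :: "('a \<times> bool) list set list \<Rightarrow> ('a \<times> bool) list set list \<Rightarrow> bool" where
  "past_bad h x \<longleftrightarrow> h \<in> lists (set_pmf \<mu>) \<and>
     (\<exists>i<5. x = tau i \<and> absorbed (inv_word (marker i)) (inv_word (wd h)))"

definition future_bad :: "('a \<times> bool) list set list \<Rightarrow> ('a \<times> bool) list set list \<Rightarrow> bool" where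
  "future_bad y x \<longleftrightarrow> y \<in> lists (set_pmf \<mu>) \<and> (\<exists>i<5. x = tau i \<and> absorbed (marker i) (wd y))"

lemma past_bad_unique: "past_bad h x \<Longrightarrow> past_bad h y \<Longrightarrow> x = y"
  unfolding past_bad_def using absorbed_inv_marker_unique wd_wds support_lists
  by (metis inv_word_in_lists)

lemma future_bad_unique: "future_bad h x \<Longrightarrow> future_bad h y \<Longrightarrow> x = y"
  unfolding future_bad_def using absorbed_marker_unique wd_wds support_lists by metis

text \<open>\<open>t\<close> is the time at which the block starts; the actual cut point lies inside
  the word of the block and need not be a position of the walk.\<close>

definition cut :: "('a \<times> bool) list set list \<Rightarrow> nat \<Rightarrow> bool" where
  "cut gs t \<longleftrightarrow> t + N \<le> length gs \<and> take N (drop t gs) \<in> tau ` {..<5} \<and>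
     \<not> past_bad (take t gs) (take N (drop t gs)) \<and> \<not> future_bad (drop (t + N) gs) (take N (drop t gs))"

text \<open>The cut point of \<open>block_gate\<close> is within \<open>cut_radius\<close> of the
  position at time \<open>t\<close>, and gates are 1-Lipschitz.\<close>

lemma cut_gate:
  assumes gs: "gs \<in> lists (set_pmf \<mu>)" and c: "cut gs t" and g: "g \<in> wds" and S: "S \<subset> V"
  defines "\<phi> \<equiv> (\<lambda>t. gate V E (raag_coset V E (cls g) S) (cls (wd (take t gs))))"
  shows "raag_dist V E (\<phi> t) (\<phi> 0) \<le> cut_radius \<or> raag_dist V E (\<phi> t) (\<phi> (length gs)) \<le> cut_radius"
proof -
  obtain i where i: "i < 5" "take N (drop t gs) = tau i" using c unfolding cut_def by auto
  let ?h = "take t gs" and ?y = "drop (t + N) gs"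
  have hy: "?h \<in> lists (set_pmf \<mu>)" "?y \<in> lists (set_pmf \<mu>)"
    using gs by (auto dest: in_set_takeD in_set_dropD)
  then have w: "wd ?h \<in> wds" "wd ?y \<in> wds" "wd (tau i) \<in> wds"
    using wd_wds support_lists tau(1) by blast+
  have split: "gs = ?h @ tau i @ ?y"
    unfolding i(2)[symmetric] by (metis append_take_drop_id drop_drop add.commute)
  have "\<not> absorbed (inv_word (marker i)) (inv_word (wd ?h))" "\<not> absorbed (marker i) (wd ?y)"
    using c hy i unfolding cut_def past_bad_def future_bad_def by auto
  then obtain r where r: "r \<in> wds" "length r \<le> cut_radius"
    "gate V E (raag_coset V E (cls g) S) (cls (wd ?h @ r)) \<in>
      {gate V E (raag_coset V E (cls g) S) (cls []),
       gate V E (raag_coset V E (cls g) S) (cls (wd ?h @ block i @ wd ?y))}"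
    using block_gate[OF w(1,2) i(1) _ _ g S] by blast
  have "cls (wd ?h @ wd (tau i) @ wd ?y) = cls (wd ?h @ block i @ wd ?y)"
    by (intro cls_append[OF HOL.refl] cls_append[OF tau(2) HOL.refl]) (use w in auto)
  moreover have "wd gs = wd ?h @ wd (tau i) @ wd ?y" by (subst split) simp
  ultimately have e: "cls (wd gs) = cls (wd ?h @ block i @ wd ?y)" by simp
  have "proj_dist V E (raag_coset V E (cls g) S) (cls (wd ?h)) (cls (wd ?h @ r)) \<le> length r"
    using proj_dist_append[OF g _ w(1) r(1)] S by blast
  then show ?thesis using r(2,3) e unfolding proj_dist_def \<phi>_def by auto
qed

section \<open>From cuts in every window to a bound on projections\<close>

definition step_bound :: nat where
  "step_bound = Max ((length \<circ> rep) ` set_pmf \<mu>)"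

lemma length_wd: "gs \<in> lists (set_pmf \<mu>) \<Longrightarrow> length (wd gs) \<le> step_bound * length gs"
proof (induction gs)
  case (Cons g gs)
  then have "length (rep g) \<le> step_bound" unfolding step_bound_def
    using finite_support by (intro Max_ge) auto
  then show ?case using Cons by auto
qed simp

lemma proj_dist_bound:
  assumes gs: "gs \<in> lists (set_pmf \<mu>)" and g: "g \<in> wds" and S: "S \<subset> V"
    and win: "\<And>t. t + m * N \<le> length gs \<Longrightarrow> \<exists>j<m. cut gs (t + j * N)"
  shows "proj_dist V E (raag_coset V E (cls g) S) (cls []) (cls (wd gs)) \<le>
    2 * cut_radius + step_bound * (m * N + 1)"
proof -
  define \<phi> where "\<phi> t = gate V E (raag_coset V E (cls g) S) (cls (wd (take t gs)))" for t
  let ?d = "raag_dist V E" and ?n = "length gs"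
  have tk: "take t gs \<in> lists (set_pmf \<mu>)" "drop t gs \<in> lists (set_pmf \<mu>)" for t
    using gs by (auto dest: in_set_takeD in_set_dropD)
  have w: "wd (take t gs) \<in> wds" for t using wd_wds support_lists tk by blast
  have car: "\<phi> t \<in> raag_carrier V E" for t
    unfolding \<phi>_def using gate_in_carrier[OF g _ w] S by blast
  have tri: "?d (\<phi> x) (\<phi> z) \<le> ?d (\<phi> x) (\<phi> y) + ?d (\<phi> y) (\<phi> z)" for x z y
    by (rule dist_triangle[OF car car car])
  have lip: "?d (\<phi> s) (\<phi> t) \<le> step_bound * (t - s)" if "s \<le> t" for s t
  proof -
    let ?r = "take (t - s) (drop s gs)"
    have r: "?r \<in> lists (set_pmf \<mu>)" using gs by (auto dest!: in_set_takeD in_set_dropD)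
    have "take t gs = take s gs @ ?r" using that take_add[of s "t - s" gs] by simp
    then have "wd (take t gs) = wd (take s gs) @ wd ?r" by (metis wd_simps(3))
    then have "?d (\<phi> s) (\<phi> t) \<le> length (wd ?r)"
      using proj_dist_append[OF g _ w[of s], of S "wd ?r"] S wd_wds[OF support_lists[OF r]]
      by (auto simp: \<phi>_def proj_dist_def)
    also have "\<dots> \<le> step_bound * length ?r" by (rule length_wd[OF r])
    also have "\<dots> \<le> step_bound * (t - s)" by simp
    finally show ?thesis .
  qed
  define J where "J = {t. t \<le> ?n \<and> ?d (\<phi> 0) (\<phi> t) \<le> cut_radius}"
  have fJ: "finite J" unfolding J_def by simp
  have "0 \<in> J" using dist_refl[OF car] by (simp add: J_def)
  define t0 where "t0 = Max J"
  have t0: "t0 \<in> J" "\<And>t. t \<in> J \<Longrightarrow> t \<le> t0"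
    unfolding t0_def using Max_in[OF fJ] Max_ge[OF fJ] \<open>0 \<in> J\<close> by blast+
  have "?d (\<phi> 0) (\<phi> ?n) \<le> 2 * cut_radius + step_bound * (m * N + 1)"
  \<comment> \<open>The window starts at \<open>t0 + 1\<close> to exclude \<open>t0\<close>, which
    costs the extra step in the bound. If no window fits, the final time itself is that close to
    \<open>t0\<close>.\<close>
  proof (cases "t0 + 1 + m * N \<le> ?n")
    case True
    then obtain j where j: "j < m" "cut gs (t0 + 1 + j * N)" using win by blast
    let ?t = "t0 + 1 + j * N"
    have "j * N \<le> m * N" using j(1) by simp
    then have tn: "?t \<le> ?n" "?t - t0 \<le> m * N + 1" using True by linarith+
    have "?t \<notin> J" using t0(2)[of ?t] by auto
    then have "\<not> ?d (\<phi> ?t) (\<phi> 0) \<le> cut_radius" using tn dist_sym[OF car car] by (simp add: J_def)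
    then have "?d (\<phi> ?t) (\<phi> ?n) \<le> cut_radius"
      using cut_gate[OF gs j(2) g S] unfolding \<phi>_def by blast
    moreover have "?d (\<phi> t0) (\<phi> ?t) \<le> step_bound * (m * N + 1)"
      using lip[of t0 ?t] mult_le_mono2[OF tn(2), of step_bound] by linarith
    moreover have "?d (\<phi> 0) (\<phi> t0) \<le> cut_radius" using t0(1) by (simp add: J_def)
    ultimately show ?thesis
      using tri[of 0 ?n t0] tri[of t0 ?n ?t] by linarith
  next
    case False
    then have "?n - t0 \<le> m * N + 1" "t0 \<le> ?n" using t0(1) by (auto simp: J_def)
    then have "?d (\<phi> t0) (\<phi> ?n) \<le> step_bound * (m * N + 1)"
      using lip[of t0 ?n] mult_le_mono2[of "?n - t0" "m * N + 1" step_bound] by linarith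
    moreover have "?d (\<phi> 0) (\<phi> t0) \<le> cut_radius" using t0(1) by (simp add: J_def)
    ultimately show ?thesis
      using tri[of 0 ?n t0] by linarith
  qed
  then show ?thesis by (simp add: \<phi>_def proj_dist_def)
qed

text \<open>Only \<open>m\<close> adjacent slots of length \<open>N\<close> are inspected, so the
  steps before, in and after them are independent and \<open>all_blocks_bad\<close> applies, with
  the rest of the walk as past and future.\<close>

lemma no_cut_prob:
  assumes "t + m * N \<le> n"
  shows "emeasure (measure_pmf (replicate_pmf n \<mu>)) {gs. \<forall>j<m. \<not> cut gs (t + j * N)} \<le> 2 * ennreal (1 - prb) ^ m"
proof -
  let ?B = "replicate_pmf N \<mu>"
  define r where "r = n - (t + m * N)"
  have n: "n = t + m * N + r" using assms by (simp add: r_def)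
  show ?thesis unfolding n replicate_pmf_blocks
  proof (rule all_blocks_bad[where L = past_bad and R = future_bad and T = "tau ` {..<5}"])
    show "card (tau ` {..<5}) = 5" by (simp add: card_image tau_inj)
    show "pmf ?B x = prb" if "x \<in> tau ` {..<5}" for x using that pmf_tau by auto
  next
    fix h xs y us x vs
    assume h: "h \<in> set_pmf (replicate_pmf t \<mu>)" and xs: "xs \<in> set_pmf (replicate_pmf m ?B)"
      and y: "y \<in> set_pmf (replicate_pmf r \<mu>)"
      and Z: "h @ concat xs @ y \<in> {gs. \<forall>j<m. \<not> cut gs (t + j * N)}"
      and e: "xs = us @ x # vs" and x: "x \<in> tau ` {..<5}"
    have lh: "length h = t" and l: "length xs = m" using h xs by (auto simp: set_replicate_pmf)
    have "\<forall>b\<in>set xs. length b = N" using xs by (auto simp: set_replicate_pmf)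
    then have lx: "length x = N" and "length (concat us) = length us * N"
      using e by (auto simp: length_concat sum_list_triv map_cong[of us us length "\<lambda>_. N"])
    moreover have "length us < m" using l e by simp
    then have "\<not> cut (h @ concat xs @ y) (t + length us * N)" using Z by blast
    ultimately have "\<not> cut ((h @ concat us) @ x @ (concat vs @ y)) (length (h @ concat us))"
      using e lh by simp
    then show "past_bad (h @ concat us) x \<or> future_bad (concat vs @ y) x"
      using x lx by (auto simp: cut_def)
  qed (auto intro: past_bad_unique future_bad_unique)
qed

text \<open>If every window contains a cut, \<open>proj_dist_bound\<close> applies. The factor 2 (n
  + 1) comes from the union over the starting times and the 2 in \<open>no_cut_prob\<close>.\<close>

lemma sup_join_proj_tail:
  "emeasure (measure_pmf (replicate_pmf n \<mu>))
     {gs. sup_join_proj V E (raag_one V E) (foldl (raag_mult V E) (raag_one V E) gs) >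
        ereal (real (2 * cut_radius + step_bound * (m * N + 1)))}
   \<le> ennreal (real (2 * (n + 1)) * (1 - prb) ^ m)"
  (is "emeasure ?M ?A \<le> _")
proof -
  let ?Z = "\<lambda>t. {gs. t + m * N \<le> n \<and> (\<forall>j<m. \<not> cut gs (t + j * N))}"
  have "?A \<inter> set_pmf (replicate_pmf n \<mu>) \<subseteq> (\<Union>t\<in>{..n}. ?Z t)"
  proof
    fix gs assume gs: "gs \<in> ?A \<inter> set_pmf (replicate_pmf n \<mu>)"
    then have g: "gs \<in> lists (set_pmf \<mu>)" "length gs = n" by (auto simp: set_replicate_pmf)
    show "gs \<in> (\<Union>t\<in>{..n}. ?Z t)"
    proof (rule ccontr)
      assume "\<not> ?thesis"
      then have win: "\<And>t. t + m * N \<le> length gs \<Longrightarrow> \<exists>j<m. cut gs (t + j * N)"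
        using g(2) by fastforce
      have "sup_join_proj V E (raag_one V E) (foldl (raag_mult V E) (raag_one V E) gs)
        \<le> ereal (real (2 * cut_radius + step_bound * (m * N + 1)))"
        using support_lists[OF g(1)]
      proof (rule sup_join_proj_le)
        fix h S assume "h \<in> wds" "S \<subseteq> V" "is_join E S"
        moreover from this have "S \<subset> V" using not_join by blast
        ultimately show "proj_dist V E (raag_coset V E (cls h) S) (cls []) (cls (wd gs)) \<le>
           2 * cut_radius + step_bound * (m * N + 1)"
          using proj_dist_bound[OF g(1) _ _ win] by blast
      qed
      then show False using gs by auto
    qed
  qed
  then have "emeasure ?M ?A \<le> emeasure ?M (\<Union>t\<in>{..n}. ?Z t)"
    by (subst emeasure_Int_set_pmf[symmetric]) (intro emeasure_mono, auto)
  also have "\<dots> \<le> (\<Sum>t\<in>{..n}. emeasure ?M (?Z t))"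
    by (rule emeasure_subadditive_finite) auto
  also have "\<dots> \<le> (\<Sum>t\<in>{..n}. 2 * ennreal (1 - prb) ^ m)"
  proof (rule sum_mono)
    fix t show "emeasure ?M (?Z t) \<le> 2 * ennreal (1 - prb) ^ m"
      using no_cut_prob[of t m n] by (cases "t + m * N \<le> n") auto
  qed
  also have "\<dots> = ennreal (real (2 * (n + 1)) * (1 - prb) ^ m)"
    using prb by (simp add: ennreal_power ennreal_mult' ennreal_of_nat_eq_real_of_nat[symmetric] mult_ac)
      (simp add: ennreal_mult'' distrib_left mult_ac ring_distribs)
  finally show ?thesis .
qed

end

subsection \<open>Logarithmic tail\<close>

text \<open>If the set \<open>R\<close> reachable from \<open>a\<close> in the complement graph were
  not all of \<open>V\<close>, then \<open>R\<close> and \<open>V - R\<close> would exhibit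
  \<open>V\<close> as a join. The closed walk is composed of excursions from \<open>a\<close> to
  each vertex and back; repeating a letter is allowed, since no vertex is adjacent to
  itself.\<close>

lemma (in raag) closed_walk:
  assumes fin: "finite V" and nj: "\<not> is_join E V" and a: "a \<in> V"
  shows "\<exists>P. chain P \<and> P \<noteq> [] \<and> hd P = (a, True) \<and> last P = (a, True) \<and> fst ` set P = V \<and> snd ` set P \<subseteq> {True}"
proof -
  define walk where "walk w v \<longleftrightarrow> chain w \<and> w \<noteq> [] \<and> hd w = (a, True) \<and> last w = (v, True) \<and>
    set w \<subseteq> V \<times> {True}" for w v
  define R where "R = {v \<in> V. \<exists>w. walk w v}"
  have "walk [(a, True)] a" using a by (auto simp: walk_def chain_single)
  then have aR: "a \<in> R" using a by (auto simp: R_def)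
  have "E v u" if v: "v \<in> R" and u: "u \<in> V - R" for v u
  proof (rule ccontr)
    assume n: "\<not> E v u"
    obtain w where "walk w v" using v by (auto simp: R_def)
    then have "walk (w @ [(u, True)]) u" using n u unfolding walk_def
      by (auto simp: chain_append chain_single)
    then show False using u by (auto simp: R_def)
  qed
  moreover have "R \<subseteq> V" by (auto simp: R_def)
  ultimately have "V - R = {}"
    using nj aR unfolding is_join_def by (metis Diff_disjoint Diff_partition empty_iff)
  then have reach: "\<exists>w. walk w v" if "v \<in> V" for v using that by (auto simp: R_def)
  have "\<exists>P. walk P a \<and> U \<subseteq> fst ` set P" if "U \<subseteq> V" for U
    using finite_subset[OF that fin] that
  proof (induction U rule: finite_induct)
    case empty
    then show ?case using reach[OF a] by auto
  next
    case (insert v U)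
    then obtain Q where Q: "walk Q a" "U \<subseteq> fst ` set Q" by auto
    have "v \<in> V" using insert.prems by simp
    then obtain w where w: "walk w v" using reach by blast
    have wr: "walk (w @ rev w) a"
    proof -
      have pos: "b \<noteq> inv_letter c" if "b \<in> set w" "c \<in> set w" for b c
        using that w by (cases b; cases c) (auto simp: walk_def)
      have "chain (rev w)"
        unfolding chain_def successively_rev
      proof (rule successively_mono)
        show "successively (\<lambda>a b. \<not> E (fst a) (fst b) \<and> b \<noteq> inv_letter a) w"
          using w unfolding walk_def chain_def by blast
      qed (use pos E_sym in auto)
      then show ?thesis using w by (auto simp: walk_def chain_append hd_rev last_rev)
    qed
    have "walk (Q @ w @ rev w) a"
      using Q(1) wr unfolding walk_def chain_append[of Q] by auto
    moreover have "v \<in> fst ` set w" using w last_in_set[of w] unfolding walk_def by force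
    ultimately show ?case using Q(2) by (intro exI[of _ "Q @ w @ rev w"]) auto
  qed
  then obtain P where P: "walk P a" "V \<subseteq> fst ` set P" by blast
  then have "fst ` set P = V" "snd ` set P \<subseteq> {True}" unfolding walk_def by auto
  then show ?thesis using P unfolding walk_def by blast
qed

lemma (in raag_walk) log_tail:
  assumes "k > 0"
  shows "\<exists>C::real>0. \<forall>n\<ge>2. emeasure (measure_pmf (replicate_pmf n \<mu>))
    {gs. sup_join_proj V E (raag_one V E) (foldl (raag_mult V E) (raag_one V E) gs) \<ge> ereal (C * ln (real n))}
    \<le> ennreal (C * real n powr (- k))"
proof -
  \<comment> \<open>As (1 - prb)^m is at most exp (- prb * m), taking \<open>m\<close> about c ln n
    gives n^-(k+1); the extra power of n pays for the union over starting times.\<close>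
  define c where "c = (k + 1) / prb"
  have c: "c > 0" using assms prb by (simp add: c_def)
  \<comment> \<open>\<open>N + 1\<close> in place of 1 accounts for rounding \<open>m\<close>
    up.\<close>
  define A where "A = real (2 * cut_radius + step_bound * (N + 1))"
  \<comment> \<open>The first term absorbs the constant \<open>A\<close>, as ln n \<ge> ln 2; the
    second comes from the window length; 4 dominates 2 (n + 1) / n.\<close>
  define C where "C = (A + 1) / ln 2 + real (step_bound * N) * c + 4"
  have C: "C \<ge> 4" using c by (simp add: C_def A_def)
  have "emeasure (measure_pmf (replicate_pmf n \<mu>))
    {gs. sup_join_proj V E (raag_one V E) (foldl (raag_mult V E) (raag_one V E) gs) \<ge> ereal (C * ln (real n))}
    \<le> ennreal (C * real n powr (- k))" (is "emeasure ?M ?A \<le> _") if n: "n \<ge> 2" for n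
  proof -
    define m where "m = nat \<lceil>c * ln (real n)\<rceil>"
    have ln: "ln (real n) \<ge> ln 2" "ln (real n) > 0" using n by auto
    have m: "real m \<ge> c * ln (real n)" "real m \<le> c * ln (real n) + 1"
      unfolding m_def using c ln by (auto simp: of_nat_ceiling)
    have "real (2 * cut_radius + step_bound * (m * N + 1)) < C * ln (real n)"
    proof -
      have "real (2 * cut_radius + step_bound * (m * N + 1))
          = real (2 * cut_radius + step_bound) + real (step_bound * N) * real m" by (simp add: algebra_simps)
      also have "\<dots> \<le> real (2 * cut_radius + step_bound) + real (step_bound * N) * (c * ln (real n) + 1)"
        using m(2) by (intro add_left_mono mult_left_mono) auto
      also have "\<dots> = A + real (step_bound * N) * c * ln (real n)" by (simp add: A_def algebra_simps)
      also have "\<dots> < (A + 1) / ln 2 * ln (real n) + real (step_bound * N) * c * ln (real n) + 4 * ln (real n)"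
      proof -
        have "A + 1 = (A + 1) / ln 2 * ln 2" by simp
        also have "\<dots> \<le> (A + 1) / ln 2 * ln (real n)"
          using ln by (intro mult_left_mono) (auto simp: A_def)
        finally show ?thesis using ln by linarith
      qed
      finally show ?thesis by (simp add: C_def algebra_simps)
    qed
    then have "?A \<subseteq> {gs. sup_join_proj V E (raag_one V E) (foldl (raag_mult V E) (raag_one V E) gs) >
        ereal (real (2 * cut_radius + step_bound * (m * N + 1)))}"
      by (auto simp del: of_nat_add of_nat_mult simp flip: less_ereal.simps(1) intro: less_le_trans)
    then have "emeasure ?M ?A \<le> ennreal (real (2 * (n + 1)) * (1 - prb) ^ m)"
      by (rule order_trans[OF emeasure_mono sup_join_proj_tail]) simp
    also have "\<dots> \<le> ennreal (C * real n powr (- k))"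
    proof (rule ennreal_leI)
      have "(1 - prb) ^ m \<le> exp (- prb) ^ m"
        using prb exp_ge_add_one_self[of "- prb"] by (intro power_mono) auto
      also have "\<dots> = exp (- (prb * real m))" by (simp add: exp_of_nat_mult[symmetric] mult.commute)
      also have "\<dots> \<le> exp (- ((k + 1) * ln (real n)))"
        using mult_left_mono[OF m(1), of prb] prb by (simp add: c_def)
      also have "\<dots> = real n powr (- k) / real n"
        using n by (simp add: powr_def exp_add[symmetric] exp_minus algebra_simps exp_diff)
          (simp add: divide_inverse mult.commute)
      finally have "real (2 * (n + 1)) * (1 - prb) ^ m \<le> real (2 * (n + 1)) * (real n powr (- k) / real n)"
        by (intro mult_left_mono) auto
      also have "\<dots> = (2 * (real n + 1) / real n) * real n powr (- k)" by simp
      also have "\<dots> \<le> C * real n powr (- k)"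
        using n C by (intro mult_right_mono) (auto simp: field_simps intro: order_trans[OF _ mult_right_mono[OF C]])
      finally show "real (2 * (n + 1)) * (1 - prb) ^ m \<le> C * real n powr (- k)" .
    qed
    finally show ?thesis .
  qed
  then show ?thesis using C by (intro exI[of _ C]) auto
qed

lemma log_tail_irreducible:
  fixes V :: "'v set" and \<mu> :: "('v \<times> bool) list set pmf"
  assumes "finite V" and E: "\<forall>v w. E v w \<longrightarrow> E w v" "\<forall>v. \<not> E v v" and nj: "\<not> is_join E V"
    and mu: "finite (set_pmf \<mu>)" "set_pmf \<mu> \<subseteq> raag_carrier V E"
      "raag_semigroup V E (set_pmf \<mu>) = raag_carrier V E"
    and k: "k > 0"
  shows "\<exists>C::real>0. \<forall>n\<ge>2. emeasure (measure_pmf (replicate_pmf n \<mu>))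
    {gs. sup_join_proj V E (raag_one V E) (foldl (raag_mult V E) (raag_one V E) gs) \<ge> ereal (C * ln (real n))}
    \<le> ennreal (C * real n powr (- k))"
proof (cases "\<exists>S\<subseteq>V. is_join E S")
  \<comment> \<open>Without any join the supremum runs over the empty set, which in
    \<open>ereal\<close> is minus infinity and below every threshold.\<close>
  case False
  then have "join_subcomplexes V E = {}" unfolding join_subcomplexes_def by auto
  then have "sup_join_proj V E x y = -\<infinity>" for x y by (simp add: sup_join_proj_def bot_ereal_def)
  then show ?thesis by (intro exI[of _ 1]) simp
next
  case True
  interpret raag V E by unfold_locales (use E in auto)
  obtain a a' where a: "a \<in> V" "a' \<in> V" "a \<noteq> a'"
    using True unfolding is_join_def by (metis Un_iff disjoint_iff ex_in_conv subsetD)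
  \<comment> \<open>Otherwise \<open>a\<close> would be adjacent to all other vertices, of which
    \<open>a'\<close> is one, and \<open>V\<close> would be a join.\<close>
  have "\<exists>b\<in>V - {a}. \<not> E a b"
  proof (rule ccontr)
    assume "\<not> ?thesis"
    then have "is_join E V" unfolding is_join_def
      using a by (intro exI[of _ "{a}"] exI[of _ "V - {a}"]) auto
    with nj show False by blast
  qed
  then obtain b where b: "b \<in> V" "b \<noteq> a" "\<not> E a b" by blast
  obtain P where P: "chain P" "P \<noteq> []" "hd P = (a, True)" "last P = (a, True)" "fst ` set P = V" "snd ` set P \<subseteq> {True}"
    using closed_walk[OF assms(1) nj a(1)] by blast
  interpret raag_walk V E a b P \<mu>
    by unfold_locales (use a b P nj mu in auto)
  show ?thesis by (rule log_tail[OF k])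
qed

subsection \<open>Sample paths\<close>

lemma rw_pmf_eq: "rw_pmf V E \<mu> n = map_pmf (foldl (raag_mult V E) (raag_one V E)) (replicate_pmf n \<mu>)"
proof (induction n)
  case (Suc n)
  have "replicate_pmf (Suc n) \<mu> = replicate_pmf (n + 1) \<mu>" by simp
  also have "\<dots> = replicate_pmf n \<mu> \<bind> (\<lambda>xs. \<mu> \<bind> (\<lambda>x. return_pmf (xs @ [x])))"
    unfolding replicate_pmf_distrib by (simp add: bind_assoc_pmf bind_return_pmf)
  finally show ?case unfolding rw_pmf.simps Suc
    by (simp add: bind_map_pmf map_bind_pmf map_pmf_def bind_assoc_pmf bind_return_pmf)
qed simp

section \<open>Cylinder events and Borel-Cantelli\<close>

lemma sets_stake_eq: "{\<omega>. stake n \<omega> = xs} \<in> sets (stream_space (measure_pmf \<mu>))"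
proof (induction n arbitrary: xs)
  case 0
  show ?case using sets.top[of "stream_space (measure_pmf \<mu>)"]
    by (cases "xs = []") (auto simp: space_stream_space)
next
  case (Suc n)
  show ?case
  proof (cases xs)
    case (Cons y ys)
    have "shd -` {y} \<inter> space (stream_space (measure_pmf \<mu>)) \<in> sets (stream_space (measure_pmf \<mu>))"
      by (rule measurable_sets[OF measurable_shd]) simp
    moreover have "stl -` {\<omega>. stake n \<omega> = ys} \<inter> space (stream_space (measure_pmf \<mu>)) \<in> sets (stream_space (measure_pmf \<mu>))"
      by (rule measurable_sets[OF measurable_stl Suc.IH])
    moreover have "{\<omega>. stake (Suc n) \<omega> = xs} = (shd -` {y} \<inter> space (stream_space (measure_pmf \<mu>))) \<inter>
      (stl -` {\<omega>. stake n \<omega> = ys} \<inter> space (stream_space (measure_pmf \<mu>)))"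
      using Cons by (auto simp: space_stream_space)
    ultimately show ?thesis by (simp only: sets.Int)
  qed simp
qed

lemma emeasure_stake_eq:
  "emeasure (stream_space (measure_pmf \<mu>)) {\<omega>. stake (length xs) \<omega> = xs} = ennreal (pmf (replicate_pmf (length xs) \<mu>) xs)"
proof (induction xs)
  case Nil
  interpret prob_space "stream_space (measure_pmf \<mu>)"
    by (rule prob_space.prob_space_stream_space[OF prob_space_measure_pmf])
  show ?case using emeasure_space_1 by (simp add: space_stream_space)
next
  case (Cons x xs)
  let ?S = "stream_space (measure_pmf \<mu>)" and ?n = "length xs"
  have "emeasure ?S {\<omega>. stake (length (x # xs)) \<omega> = x # xs} =
      (\<integral>\<^sup>+t. emeasure ?S {\<omega>. stake ?n \<omega> = xs} * indicator {x} t \<partial>measure_pmf \<mu>)"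
    by (subst prob_space.emeasure_stream_space[OF prob_space_measure_pmf sets_stake_eq], intro nn_integral_cong)
      (auto simp: space_stream_space indicator_def)
  also have "\<dots> = emeasure ?S {\<omega>. stake ?n \<omega> = xs} * emeasure (measure_pmf \<mu>) {x}"
    by (subst nn_integral_cmult_indicator) auto
  also have "\<dots> = ennreal (pmf (replicate_pmf (length (x # xs)) \<mu>) (x # xs))"
    unfolding Cons pmf_replicate_pmf by (simp add: emeasure_pmf_single ennreal_mult' mult.commute)
  finally show ?case .
qed

text \<open>Over an arbitrary type the product of discrete sigma-algebras may be smaller than the
  power set, so events on initial segments are reduced to finite unions of cylinders.\<close>

lemma emeasure_stake_finite:
  assumes "finite A" "\<And>xs. xs \<in> A \<Longrightarrow> length xs = n"
  shows "{\<omega>. stake n \<omega> \<in> A} \<in> sets (stream_space (measure_pmf \<mu>))"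
    and "emeasure (stream_space (measure_pmf \<mu>)) {\<omega>. stake n \<omega> \<in> A} = emeasure (measure_pmf (replicate_pmf n \<mu>)) A"
proof -
  let ?S = "stream_space (measure_pmf \<mu>)"
  have U: "{\<omega>. stake n \<omega> \<in> A} = (\<Union>xs\<in>A. {\<omega>. stake n \<omega> = xs})" by auto
  show "{\<omega>. stake n \<omega> \<in> A} \<in> sets ?S"
    unfolding U using assms(1) sets_stake_eq by (intro sets.finite_UN) auto
  have "emeasure ?S {\<omega>. stake n \<omega> \<in> A} = (\<Sum>xs\<in>A. emeasure ?S {\<omega>. stake n \<omega> = xs})"
    unfolding U using assms(1) sets_stake_eq
    by (intro sum_emeasure[symmetric]) (auto simp: disjoint_family_on_def)
  also have "\<dots> = (\<Sum>xs\<in>A. ennreal (pmf (replicate_pmf n \<mu>) xs))"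
    using emeasure_stake_eq assms(2) by (intro sum.cong) auto
  also have "\<dots> = emeasure (measure_pmf (replicate_pmf n \<mu>)) A"
    using assms(1) by (simp add: emeasure_measure_pmf_finite)
  finally show "emeasure ?S {\<omega>. stake n \<omega> \<in> A} = emeasure (measure_pmf (replicate_pmf n \<mu>)) A" .
qed

text \<open>Exceptional lists are restricted to the finite support, which makes their sets finite
  and the events measurable. Borel-Cantelli applies to these, and almost every path stays in the
  support.\<close>

lemma AE_eventually_stake:
  fixes \<mu> :: "'c pmf" and c :: "nat \<Rightarrow> real"
  assumes fin: "finite (set_pmf \<mu>)" and c: "summable c" "\<And>n. c n \<ge> 0"
    and Q: "\<And>n. n \<ge> n0 \<Longrightarrow> emeasure (measure_pmf (replicate_pmf n \<mu>)) {xs. \<not> Q n xs} \<le> ennreal (c n)"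
  shows "AE \<omega> in stream_space (measure_pmf \<mu>).
    (\<forall>n. stake n \<omega> \<in> lists (set_pmf \<mu>)) \<and> (\<forall>\<^sub>F n in sequentially. Q n (stake n \<omega>))"
proof -
  let ?S = "stream_space (measure_pmf \<mu>)"
  define A where "A n = (if n < n0 then {} else {xs. length xs = n \<and> set xs \<subseteq> set_pmf \<mu> \<and> \<not> Q n xs})" for n
  have finA: "finite (A n)" and lenA: "xs \<in> A n \<Longrightarrow> length xs = n" for n xs
    by (rule finite_subset[OF _ finite_lists_length_eq[OF fin, of n]]) (auto simp: A_def split: if_splits)
  have le: "emeasure ?S {\<omega>. stake n \<omega> \<in> A n} \<le> ennreal (c n)" for n
  proof (cases "n < n0")
    case False
    have "emeasure ?S {\<omega>. stake n \<omega> \<in> A n} = emeasure (measure_pmf (replicate_pmf n \<mu>)) (A n)"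
      using emeasure_stake_finite(2)[OF finA lenA] by blast
    also have "\<dots> \<le> emeasure (measure_pmf (replicate_pmf n \<mu>)) {xs. \<not> Q n xs}"
      by (intro emeasure_mono) (auto simp: A_def)
    finally show ?thesis using Q[of n] False by (meson leI order_trans)
  qed (simp add: A_def)
  have "AE \<omega> in ?S. \<forall>\<^sub>F n in sequentially. \<omega> \<in> space ?S - {\<omega>. stake n \<omega> \<in> A n}"
  proof (rule borel_cantelli_AE1)
    show "{\<omega>. stake n \<omega> \<in> A n} \<in> sets ?S" for n using emeasure_stake_finite(1)[OF finA lenA] by blast
    show "emeasure ?S {\<omega>. stake n \<omega> \<in> A n} < \<infinity>" for n using le[of n] by (simp add: le_less_trans)
    have "measure ?S {\<omega>. stake n \<omega> \<in> A n} \<le> c n" for n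
      unfolding measure_def using enn2real_mono[OF le[of n]] c(2) by simp
    then show "summable (\<lambda>n. measure ?S {\<omega>. stake n \<omega> \<in> A n})"
      by (intro summable_comparison_test'[OF c(1)]) auto
  qed
  moreover have "AE \<omega> in ?S. stream_all (\<lambda>x. x \<in> set_pmf \<mu>) \<omega>"
    by (rule prob_space.AE_stream_all[OF prob_space_measure_pmf]) (auto simp: AE_measure_pmf)
  ultimately show ?thesis
  proof eventually_elim
    case (elim \<omega>)
    have st: "set (stake n \<omega>) \<subseteq> set_pmf \<mu>" for n
      using elim(2) by (auto simp: stream_all_def in_set_conv_nth)
    have "\<forall>\<^sub>F n in sequentially. Q n (stake n \<omega>)"
      using elim(1) eventually_ge_at_top[of n0]
      by eventually_elim (use st in \<open>auto simp: A_def split: if_splits\<close>)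
    then show ?case using st by auto
  qed
qed

lemma powr_tail_summable: "summable (\<lambda>n. C * real n powr (- 2))"
  using summable_real_powr_iff[of "-2"] by (intro summable_mult) simp

theorem theoremA12:
  fixes V :: "'v set" and E :: "'v \<Rightarrow> 'v \<Rightarrow> bool"
    and \<mu> :: "('v \<times> bool) list set pmf"
  assumes "finite V"
    and "\<forall>v w. E v w \<longrightarrow> v \<in> V \<and> w \<in> V"
    and "\<forall>v w. E v w \<longrightarrow> E w v"
    and "\<forall>v. \<not> E v v"
    and "\<not> is_join E V"
    and "finite (set_pmf \<mu>)"
    and "set_pmf \<mu> \<subseteq> raag_carrier V E"
    and "raag_semigroup V E (set_pmf \<mu>) = raag_carrier V E"
  shows "(\<forall>k::real. k > 0 \<longrightarrow> (\<exists>C::real. C > 0 \<and> (\<forall>n::nat. n \<ge> 2 \<longrightarrow>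
            measure_pmf.prob (rw_pmf V E \<mu> n)
              {g. sup_join_proj V E (raag_one V E) g \<ge> ereal (C * ln (real n))}
            \<le> C * real n powr (- k))))
       \<and> (AE \<omega> in stream_space (measure_pmf \<mu>). \<exists>C::real. C > 0 \<and> (\<forall>n::nat. n \<ge> 2 \<longrightarrow>
            sup_join_proj V E (raag_one V E) (rw_path V E \<omega> n) \<le> ereal (C * ln (real n))))"
proof (intro conjI allI impI)
  interpret raag V E by unfold_locales (use assms(3,4) in auto)
  let ?s = "\<lambda>g. sup_join_proj V E (raag_one V E) g" and ?w = "foldl (raag_mult V E) (raag_one V E)"
  note tail = log_tail_irreducible[OF assms(1,3-8)]
  {
    fix k :: real assume "k > 0"
    then obtain C where C: "C > 0" "\<And>n. n \<ge> 2 \<Longrightarrow> emeasure (measure_pmf (replicate_pmf n \<mu>))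
      {gs. ?s (?w gs) \<ge> ereal (C * ln (real n))} \<le> ennreal (C * real n powr (- k))"
      using tail by blast
    have "measure_pmf.prob (rw_pmf V E \<mu> n) {g. ?s g \<ge> ereal (C * ln (real n))} \<le> C * real n powr (- k)"
      if "n \<ge> 2" for n
    proof -
      have "measure_pmf.prob (rw_pmf V E \<mu> n) {g. ?s g \<ge> ereal (C * ln (real n))} =
        measure_pmf.prob (replicate_pmf n \<mu>) {gs. ?s (?w gs) \<ge> ereal (C * ln (real n))}"
        unfolding rw_pmf_eq by (simp add: vimage_def)
      then show ?thesis using C(2)[OF that] C(1)
        by (simp add: measure_pmf.emeasure_eq_measure)
    qed
    then show "\<exists>C>0. \<forall>n\<ge>2. measure_pmf.prob (rw_pmf V E \<mu> n) {g. ?s g \<ge> ereal (C * ln (real n))} \<le> C * real n powr (- k)"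
      using C(1) by blast
  }
  \<comment> \<open>An exponent above 1 makes the tail summable, as Borel-Cantelli requires; 2 is
    taken.\<close>
  obtain C where C: "C > 0" "\<And>n. n \<ge> 2 \<Longrightarrow> emeasure (measure_pmf (replicate_pmf n \<mu>))
    {gs. ?s (?w gs) \<ge> ereal (C * ln (real n))} \<le> ennreal (C * real n powr (- 2))"
    using tail[of 2] by auto
  have "AE \<omega> in stream_space (measure_pmf \<mu>). (\<forall>n. stake n \<omega> \<in> lists (set_pmf \<mu>)) \<and>
    (\<forall>\<^sub>F n in sequentially. \<not> ?s (?w (stake n \<omega>)) \<ge> ereal (C * ln (real n)))"
    by (rule AE_eventually_stake[of \<mu> "\<lambda>n. C * real n powr (- 2)" 2, OF assms(6) powr_tail_summable[of C]])
      (use C in auto)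
  then show "AE \<omega> in stream_space (measure_pmf \<mu>). \<exists>C>0. \<forall>n\<ge>2.
      ?s (rw_path V E \<omega> n) \<le> ereal (C * ln (real n))"
  proof eventually_elim
    case (elim \<omega>)
    then obtain n1 where n1: "\<And>n. n \<ge> n1 \<Longrightarrow> \<not> ?s (?w (stake n \<omega>)) \<ge> ereal (C * ln (real n))"
      by (auto simp: eventually_sequentially)
    define L where "L n = real (length (wd (stake n \<omega>)))" for n
    have L: "?s (?w (stake n \<omega>)) \<le> ereal (L n)" for n
      unfolding L_def using elim assms(7) by (intro sup_join_proj_finite) auto
    \<comment> \<open>The sum of the crude bounds covers all times before \<open>n1\<close>; the
      division by ln 2 is compensated by ln n \<ge> ln 2.\<close>
    define D where "D = C + (\<Sum>n<n1. L n) / ln 2"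
    have S0: "(\<Sum>n<n1. L n) \<ge> 0" by (intro sum_nonneg) (simp add: L_def)
    have D: "D \<ge> C" using S0 by (simp add: D_def)
    have "?s (?w (stake n \<omega>)) \<le> ereal (D * ln (real n))" if n: "n \<ge> 2" for n
    proof (cases "n \<ge> n1")
      case True
      then have "?s (?w (stake n \<omega>)) \<le> ereal (C * ln (real n))" using n1[of n] by auto
      also have "\<dots> \<le> ereal (D * ln (real n))" using D n by (simp add: mult_right_mono)
      finally show ?thesis .
    next
      case False
      have "L n \<le> (\<Sum>n<n1. L n)"
        using False by (intro member_le_sum) (auto simp: L_def)
      also have "\<dots> = (\<Sum>n<n1. L n) / ln 2 * ln 2" by simp
      also have "\<dots> \<le> (\<Sum>n<n1. L n) / ln 2 * ln (real n)"
        using S0 n by (intro mult_left_mono) auto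
      also have "\<dots> \<le> D * ln (real n)" using C(1) n by (intro mult_right_mono) (auto simp: D_def)
      finally show ?thesis using L[of n] by (meson ereal_less_eq(3) order_trans)
    qed
    then show ?case using C(1) D unfolding rw_path_def by (intro exI[of _ D]) auto
  qed
qed

end
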